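(* There exists a uniform (absolute) constant $C_0>0$ such that the following holds. Let $\Phi\colon [0,\infty)\to [0,\infty)$ be an increasing convex function and suppose that $h\colon S^1\to S^1$ is an orientation-preserving homeomorphism such that $$\int_0^{2\pi} \int_0^{\pi/2} \Phi(q \rho_h^c(\theta,t)) \, dt\,d\theta <\infty$$ for some $q>0$. Then there exists an extension of $h$ to a homeomorphism $H$ of $\mathbb{D}$ that has finite distortion and $$\int_{\mathbb{D}} \Phi( qC_0^{-1}K_H(x,y)) \, dx\,dy<\infty.$$
   Context: $\mathbb{D}$ is the open unit disk in the plane and $S^1=\partial\mathbb{D}$. For $a,b\in S^1$, $\ell(a,b)$ denotes the length of the arc of the circle that connects $a$ to $b$ in the positive orientation. For an orientation-preserving homeomorphism $h\colon S^1\to S^1$, the circular symmetric distortion function is $$\rho_h^c(\theta,t)= \max \left\{ \frac{\ell(h(e^{i\theta}),h(e^{i(\theta+t)}))}{\ell(h(e^{i(\theta-t)}),h(e^{i\theta}))}, \frac{\ell(h(e^{i(\theta-t)}),h(e^{i\theta}))}{\ell(h(e^{i\theta}),h(e^{i(\theta+t)}))} \right\}$$ for $\theta\in[0,2\pi]$ and $t\in(0,\pi/2)$. A homeomorphism $H\colon U\to V$ between open sets $U,V\subset\mathbb{R}^2$ is a mapping of finite distortion if $H$ is orientation-preserving, $H\in W^{1,1}_{\mathrm{loc}}(U)$, the Jacobian $J_H$ lies in $L^1_{\mathrm{loc}}(U)$, and the quasiconformal dilatation $K_H(x,y)=\inf\{K\ge 1: \|DH(x,y)\|^2\le K J_H(x,y)\}$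 (with $\|DH\|$ the operator norm of the differential matrix) is finite a.e. in $U$. An extension of $h$ to a homeomorphism of $\mathbb{D}$ is a homeomorphism $H\colon\overline{\mathbb{D}}\to\overline{\mathbb{D}}$ with $H(\mathbb{D})=\mathbb{D}$ and $H|_{S^1}=h$; finite distortion and $K_H$ refer to $H|_{\mathbb{D}}$. *)

theory Defs
  imports "HOL-Complex_Analysis.Complex_Analysis"
begin

text \<open>The plane is identified with the type of complex numbers; the open unit disk is
  \<open>ball 0 1\<close> and the unit circle is \<open>sphere 0 1\<close>.\<close>

subsection \<open>Circle homeomorphisms\<close>

text \<open>For \<open>a\<close>, \<open>b\<close> on the unit circle, \<open>Arg2pi (b / a)\<close> is the unique \<open>t\<close> in \<open>[0, 2\<pi>)\<close> with
  \<open>b = a * cis t\<close>, that is, the length of the arc traversed from \<open>a\<close> counterclockwise to \<open>b\<close>.\<close>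

definition arc_len :: "complex \<Rightarrow> complex \<Rightarrow> real" where
  "arc_len a b = Arg2pi (b / a)"

definition rho_c :: "(complex \<Rightarrow> complex) \<Rightarrow> real \<Rightarrow> real \<Rightarrow> real" where
  "rho_c h \<theta> t =
     max (arc_len (h (cis \<theta>)) (h (cis (\<theta> + t))) / arc_len (h (cis (\<theta> - t))) (h (cis \<theta>)))
         (arc_len (h (cis (\<theta> - t))) (h (cis \<theta>)) / arc_len (h (cis \<theta>)) (h (cis (\<theta> + t))))"

text \<open>A circle homeomorphism preserves the orientation if it lifts to an increasing map of the
  real line under the universal covering \<open>cis\<close>.\<close>

definition circle_homeo_op :: "(complex \<Rightarrow> complex) \<Rightarrow> bool" where
  "circle_homeo_op h \<longleftrightarrow>
     (\<exists>g. homeomorphism (sphere 0 1) (sphere 0 1) h g) \<and>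
     (\<exists>\<phi>::real \<Rightarrow> real. continuous_on UNIV \<phi> \<and> strict_mono \<phi> \<and> (\<forall>x. h (cis x) = cis (\<phi> x)))"

subsection \<open>Weak derivatives\<close>

definition locally_integrable_on ::
    "('a::euclidean_space \<Rightarrow> 'b::euclidean_space) \<Rightarrow> 'a set \<Rightarrow> bool" where
  "locally_integrable_on f U \<longleftrightarrow> (\<forall>K. compact K \<and> K \<subseteq> U \<longrightarrow> f absolutely_integrable_on K)"

primrec C_k :: "nat \<Rightarrow> ('a::euclidean_space \<Rightarrow> real) \<Rightarrow> bool" where
  "C_k 0 f \<longleftrightarrow> continuous_on UNIV f"
| "C_k (Suc n) f \<longleftrightarrow> (\<forall>x. f differentiable at x) \<and>
     (\<forall>e\<in>Basis. C_k n (\<lambda>x. frechet_derivative f (at x) e))"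

definition test_function :: "'a::euclidean_space set \<Rightarrow> ('a \<Rightarrow> real) \<Rightarrow> bool" where
  "test_function U \<phi> \<longleftrightarrow> (\<forall>n. C_k n \<phi>) \<and>
     compact (closure {x. \<phi> x \<noteq> 0}) \<and> closure {x. \<phi> x \<noteq> 0} \<subseteq> U"

text \<open>\<open>weak_derivative_on f D U\<close> expresses that \<open>f\<close> belongs to the local Sobolev space
  \<open>W\<^sup>1\<^sup>,\<^sup>1\<close> of \<open>U\<close> with weak differential \<open>D\<close>. For open \<open>U\<close>, \<open>D\<close> is determined by \<open>f\<close> up to a
  null subset of \<open>U\<close>.\<close>

definition weak_derivative_on ::
    "('a::euclidean_space \<Rightarrow> 'b::euclidean_space) \<Rightarrow> ('a \<Rightarrow> 'a \<Rightarrow>\<^sub>L 'b) \<Rightarrow> 'a set \<Rightarrow> bool" where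
  "weak_derivative_on f D U \<longleftrightarrow> locally_integrable_on f U \<and>
     (\<forall>e\<in>Basis. locally_integrable_on (\<lambda>x. blinfun_apply (D x) e) U \<and>
        (\<forall>\<phi>. test_function U \<phi> \<longrightarrow>
           (LINT x:U|lebesgue. frechet_derivative \<phi> (at x) e *\<^sub>R f x) =
             - (LINT x:U|lebesgue. \<phi> x *\<^sub>R blinfun_apply (D x) e)))"

subsection \<open>Mappings of finite distortion\<close>

definition jac :: "(complex \<Rightarrow>\<^sub>L complex) \<Rightarrow> real" where
  "jac A = Re (blinfun_apply A 1) * Im (blinfun_apply A \<i>) -
           Re (blinfun_apply A \<i>) * Im (blinfun_apply A 1)"

text \<open>The infimum of the empty set is \<open>\<infinity>\<close>; the norm on bounded linear maps is the operator
  norm.\<close>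

definition dilatation :: "(complex \<Rightarrow>\<^sub>L complex) \<Rightarrow> ennreal" where
  "dilatation A = (INF K \<in> {K. 1 \<le> K \<and> (norm A)\<^sup>2 \<le> K * jac A}. ennreal K)"

text \<open>For a homeomorphism between open sets in the plane, preserving the orientation means having
  local degree 1 at each point.\<close>

definition orientation_preserving_on :: "complex set \<Rightarrow> (complex \<Rightarrow> complex) \<Rightarrow> bool" where
  "orientation_preserving_on U H \<longleftrightarrow>
     (\<forall>z r. r > 0 \<and> cball z r \<subseteq> U \<longrightarrow> winding_number (H \<circ> circlepath z r) (H z) = 1)"

text \<open>The weak differential \<open>D\<close> of \<open>H\<close> is an explicit argument, so that the dilatation of \<open>H\<close> is
  \<open>\<lambda>z. dilatation (D z)\<close>. By the uniqueness of \<open>D\<close> up to a null set, the choice of \<open>D\<close>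
  affects neither this predicate nor integrals of the dilatation over \<open>U\<close>.\<close>

definition finite_distortion ::
    "complex set \<Rightarrow> complex set \<Rightarrow> (complex \<Rightarrow> complex) \<Rightarrow> (complex \<Rightarrow> complex \<Rightarrow>\<^sub>L complex) \<Rightarrow> bool" where
  "finite_distortion U V H D \<longleftrightarrow>
     open U \<and> open V \<and> (\<exists>G. homeomorphism U V H G) \<and>
     orientation_preserving_on U H \<and>
     weak_derivative_on H D U \<and>
     locally_integrable_on (\<lambda>z. jac (D z)) U \<and>
     (AE z in lebesgue. z \<in> U \<longrightarrow> dilatation (D z) < \<infinity>)"

definition disk_extension :: "(complex \<Rightarrow> complex) \<Rightarrow> (complex \<Rightarrow> complex) \<Rightarrow> bool" where
  "disk_extension h H \<longleftrightarrow>
     (\<exists>G. homeomorphism (cball 0 1) (cball 0 1) H G) \<and> H ` ball 0 1 = ball 0 1 \<and>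
     (\<forall>z\<in>sphere 0 1. H z = h z)"

end

theory Submission
  imports Defs
begin

text \<open>
  Let \<open>\<phi>\<close> be an increasing lift of \<open>h\<close> to the real line, so that \<open>\<phi> (x + 2\<pi>) = \<phi> x + 2\<pi>\<close>. The
  Beurling--Ahlfors map of the upper half-plane is
  \<open>F (x + i y) = (a + b) / 2 + i (a - b)\<close>, where \<open>a\<close> and \<open>b\<close> are the means of \<open>\<phi>\<close> over
  \<open>[x, x + y]\<close> and \<open>[x - y, x]\<close>. It commutes with the translation by \<open>2\<pi>\<close>, so the covering
  \<open>w \<mapsto> exp (i w)\<close> carries it to a map of the punctured disk, which extends by \<open>0 \<mapsto> 0\<close>; as the
  covering is conformal, the dilatation is unchanged.

  The heart of the matter is a bound for the dilatation that is linear in the symmetric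
  distortion \<open>\<rho>\<close> (lemma \<open>BA_distortion\<close>). Let \<open>\<alpha>\<close> and \<open>\<beta>\<close> be the increments of \<open>\<phi>\<close> over
  \<open>[x, x + y]\<close> and \<open>[x - y, x]\<close>, and put \<open>\<alpha>' = \<phi> (x + y) - a\<close>, \<open>\<beta>' = b - \<phi> (x - y)\<close>. Then \<open>F\<close> has
  Jacobian \<open>(\<alpha> \<beta>' + \<alpha>' \<beta>) / y\<^sup>2\<close> and Hilbert--Schmidt norm at most \<open>sqrt (5 / 2) (\<alpha> + \<beta>) / y\<close>.
  By symmetry let \<open>\<beta> \<le> \<alpha>\<close>; the dilatation is then at most \<open>10 \<alpha>\<^sup>2 / (\<alpha> \<beta>' + \<alpha>' \<beta>)\<close>. If
  \<open>\<alpha>' \<ge> \<alpha> / 6\<close>, this is at most \<open>60 \<alpha> / \<beta> \<le> 60 \<rho> (x, y)\<close>. Otherwise the mean \<open>a\<close> is so close to the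
  final value \<open>\<phi> (x + y)\<close> that at least half of \<open>\<alpha>\<close> is gained on the first third \<open>[x, x + y / 3]\<close>.
  The single symmetric pair of intervals \<open>[x - y, x - y / 3]\<close> and \<open>[x - y / 3, x + y / 3]\<close> compares
  that gain with \<open>\<beta>'\<close>, and the dilatation is at most \<open>60 \<rho> (x - y / 3, 2 y / 3)\<close>.
  Avoiding a chain of two comparisons is what keeps the bound linear.

  So the dilatation at \<open>x + i y\<close> is at most \<open>60\<close> times the largest of \<open>\<rho> (x, y)\<close> and
  \<open>\<rho> (x \<plusminus> y / 3, 2 y / 3)\<close>. These arguments depend linearly on \<open>(x, y)\<close>, so for \<open>y < \<pi> / 2\<close> the integral
  of \<open>\<Phi>\<close> of the dilatation is controlled by the given one through linear changes of variables, after the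
  passage to polar coordinates (\<open>polar_annulus\<close>, \<open>sym_dist3_integral_finite\<close>). For \<open>y \<ge> \<pi> / 2\<close>
  periodicity bounds \<open>\<rho>\<close> by a constant that depends on \<open>h\<close>, which suffices on a set of finite area.

  The remaining properties are soft. \<open>F\<close> is injective because the mean over an interval is
  strictly increasing in both end points (\<open>BA_inj\<close>); it is onto by invariance of domain and
  connectedness (\<open>disk_extension_BAext\<close>). A small circle can be deformed to the unit circle inside
  the closed disk together with its centre, so the local degree is the degree of \<open>h\<close>
  (\<open>orientation_preserving_BAext\<close>). The map is differentiable off the origin with a derivative
  bounded near it, so the fundamental theorem of calculus on lines missing the origin yields the
  weak derivative (\<open>weak_derivative_punctured\<close>).
\<close>

section \<open>Lifts of circle homeomorphisms and their means\<close>

text \<open>Increasing lifts, under the covering \<open>cis\<close>, of circle maps of degree one.\<close>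

locale circle_lift =
  fixes \<phi> :: "real \<Rightarrow> real"
  assumes cont: "continuous_on UNIV \<phi>"
    and mono: "strict_mono \<phi>"
    and period: "\<phi> (x + 2 * pi) = \<phi> x + 2 * pi"

text \<open>The increment of a lift over a period is \<open>2\<pi>n\<close> with \<open>n > 0\<close>. For \<open>n \<ge> 2\<close> the lift would pass
  through \<open>\<phi> x + 2\<pi>\<close> strictly inside the period, against injectivity of \<open>h\<close>.\<close>

lemma circle_homeo_op_lift:
  assumes "circle_homeo_op h"
  obtains \<phi> g where "circle_lift \<phi>" "\<And>x. h (cis x) = cis (\<phi> x)" "homeomorphism (sphere 0 1) (sphere 0 1) h g"
proof -
  obtain g \<phi> where g: "homeomorphism (sphere 0 1) (sphere 0 1) h g"
    and \<phi>: "continuous_on UNIV \<phi>" "strict_mono \<phi>" "\<And>x. h (cis x) = cis (\<phi> x)"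
    using assms unfolding circle_homeo_op_def by blast
  have inj: "cis x = cis y" if "h (cis x) = h (cis y)" for x y
    using homeomorphism_apply1[OF g] that by (metis mem_sphere_0 norm_cis)
  have cis_eq: "cis a = cis b \<longleftrightarrow> (\<exists>n::int. a = b + 2 * pi * of_int n)" for a b
    using sin_cos_eq_iff[of a b] by (auto simp: complex_eq_iff)
  have "\<phi> (x + 2 * pi) = \<phi> x + 2 * pi" for x
  proof -
    have "cis (x + 2 * pi) = cis x" by (simp flip: cis_mult)
    then have "cis (\<phi> (x + 2 * pi)) = cis (\<phi> x)" using \<phi>(3) by metis
    then obtain n :: int where n: "\<phi> (x + 2 * pi) = \<phi> x + 2 * pi * of_int n" unfolding cis_eq by blast
    have "\<phi> x < \<phi> (x + 2 * pi)" using \<phi>(2) by (simp add: strict_monoD)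
    then have "n > 0" using n by (simp add: zero_less_mult_iff)
    moreover have "\<not> n \<ge> 2"
    proof
      assume n2: "n \<ge> 2"
      then have "2 * pi * of_int n \<ge> 2 * pi * 2" by (intro mult_left_mono) auto
      then have "\<phi> x \<le> \<phi> x + 2 * pi" "\<phi> x + 2 * pi \<le> \<phi> (x + 2 * pi)" using n pi_gt_zero by linarith+
      then obtain y where y: "x \<le> y" "y \<le> x + 2 * pi" "\<phi> y = \<phi> x + 2 * pi"
        using IVT'[of \<phi> x "\<phi> x + 2 * pi" "x + 2 * pi"] continuous_on_subset[OF \<phi>(1)] by auto
      have ne: "y \<noteq> x" "y \<noteq> x + 2 * pi" using y n n2 by auto
      have "cis (\<phi> y) = cis (\<phi> x)" unfolding y(3) by (simp flip: cis_mult)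
      then have "cis y = cis x" using inj \<phi>(3) by metis
      then obtain m :: int where m: "y = x + 2 * pi * of_int m" unfolding cis_eq by blast
      have "x < y" "y < x + 2 * pi" using y ne by linarith+
      then have "0 < 2 * pi * real_of_int m" "2 * pi * real_of_int m < 2 * pi * 1" unfolding m by linarith+
      then have "0 < real_of_int m" "real_of_int m < 1"
        by (simp_all add: zero_less_mult_iff)
      then show False by simp
    qed
    ultimately have "n = 1" by simp
    then show ?thesis using n by simp
  qed
  then have "circle_lift \<phi>" using \<phi> by (simp add: circle_lift_def)
  then show thesis using that \<phi>(3) g by blast
qed

context circle_lift
begin

definition prim :: "real \<Rightarrow> real" where
  "prim = (SOME P. \<forall>x. (P has_real_derivative \<phi> x) (at x))"

lemma prim_deriv: "(prim has_real_derivative \<phi> x) (at x)"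
proof -
  have "\<exists>P. \<forall>x::real. -\<infinity> < ereal x \<longrightarrow> ereal x < \<infinity> \<longrightarrow> (P has_vector_derivative \<phi> x) (at x)"
    using cont by (intro einterval_antiderivative) (auto simp: continuous_on_eq_continuous_at)
  then have "\<exists>P. \<forall>x. (P has_real_derivative \<phi> x) (at x)"
    by (simp add: has_real_derivative_iff_has_vector_derivative)
  from someI_ex[OF this] show ?thesis unfolding prim_def by blast
qed

lemmas prim_deriv' [derivative_intros] = prim_deriv[THEN DERIV_chain2]

lemma isCont_prim: "isCont prim x"
  using prim_deriv DERIV_isCont by blast

lemma continuous_lift [continuous_intros]:
  "continuous_on S f \<Longrightarrow> continuous_on S (\<lambda>x. \<phi> (f x))"
  using continuous_on_compose2[OF cont] by auto

lemma less_iff [simp]: "\<phi> x < \<phi> y \<longleftrightarrow> x < y"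
  using mono by (simp add: strict_mono_less)

lemma le_iff [simp]: "\<phi> x \<le> \<phi> y \<longleftrightarrow> x \<le> y"
  using mono by (simp add: strict_mono_less_eq)

lemma measurable_lift [measurable]: "\<phi> \<in> borel_measurable borel"
  by (rule borel_measurable_continuous_onI[OF cont])

lemma lift_eq_iff [simp]: "\<phi> x = \<phi> y \<longleftrightarrow> x = y"
  using strict_mono_eq[OF mono] .

lemma period_int: "\<phi> (x + 2 * pi * of_int n) = \<phi> x + 2 * pi * of_int n"
proof (induction n rule: int_induct[where k = 0])
  case (step1 i)
  then show ?case using period[of "x + 2 * pi * of_int i"] by (simp add: algebra_simps)
next
  case (step2 i)
  then show ?case using period[of "x + 2 * pi * of_int (i - 1)"] by (simp add: algebra_simps)
qed simp

text \<open>Compare \<open>t\<close> with the two translates of \<open>s\<close> by whole periods that enclose it.\<close>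

lemma increment_bounds:
  assumes "s \<le> t"
  shows "\<phi> t - \<phi> s \<le> t - s + 2 * pi" and "t - s - 2 * pi \<le> \<phi> t - \<phi> s"
proof -
  define n where "n = \<lfloor>(t - s) / (2 * pi)\<rfloor>"
  have n: "s + 2 * pi * of_int n \<le> t" "t \<le> s + 2 * pi * of_int (n + 1)"
    using floor_correct[of "(t - s) / (2 * pi)"] unfolding n_def[symmetric]
    by (auto simp: field_simps)
  then have "\<phi> s + 2 * pi * of_int n \<le> \<phi> t" "\<phi> t \<le> \<phi> s + 2 * pi * of_int (n + 1)"
    using period_int le_iff by metis+
  with n show "\<phi> t - \<phi> s \<le> t - s + 2 * pi" "t - s - 2 * pi \<le> \<phi> t - \<phi> s"
    by (auto simp: algebra_simps)
qed

lemma prim_period: "prim (t + 2 * pi) - prim (s + 2 * pi) = prim t - prim s + 2 * pi * (t - s)"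
proof -
  let ?f = "\<lambda>x. prim (x + 2 * pi) - prim x - 2 * pi * x"
  have "(?f has_real_derivative 0) (at x)" for x
    by (auto intro!: derivative_eq_intros simp: period)
  then have "?f t = ?f s" using DERIV_const_ratio_const2 DERIV_isconst_all by blast
  then show ?thesis by (simp add: algebra_simps)
qed

text \<open>The mean value of \<open>\<phi>\<close> over the interval between \<open>s\<close> and \<open>t\<close>, in either order. The value on the
  diagonal is the one that makes it continuous, and it gives the boundary values of the extension.\<close>

definition mean :: "real \<Rightarrow> real \<Rightarrow> real" where
  "mean s t = (if s = t then \<phi> s else (prim t - prim s) / (t - s))"

lemma mean_self [simp]: "mean s s = \<phi> s"
  by (simp add: mean_def)

lemma mean_commute: "mean s t = mean t s"
  by (simp add: mean_def field_simps)

lemma mean_period: "mean (s + 2 * pi) (t + 2 * pi) = mean s t + 2 * pi"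
proof (cases "s = t")
  case True
  then show ?thesis by (simp add: period)
next
  case False
  then show ?thesis using prim_period[of t s] by (simp add: mean_def field_simps)
qed

lemma mean_mult: "mean s t * (t - s) = prim t - prim s"
  by (simp add: mean_def)

lemma mean_between:
  assumes "s < t" shows "\<phi> s < mean s t" "mean s t < \<phi> t"
proof -
  obtain z where "s < z" "z < t" "prim t - prim s = (t - s) * \<phi> z"
    using MVT2[OF assms prim_deriv] by blast
  moreover from this have "mean s t = \<phi> z" using assms by (simp add: mean_def)
  ultimately show "\<phi> s < mean s t" "mean s t < \<phi> t" by auto
qed

text \<open>The mean over \<open>[s, t']\<close> is a convex combination of the means over \<open>[s, t]\<close> and \<open>[t, t']\<close>, and
  \<open>\<phi> t\<close> separates these two.\<close>

lemma mean_less: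
  assumes "s < t" "t < t'"
  shows "mean s t < mean s t'" "mean s t' < mean t t'"
proof -
  have eq: "mean s t' * (t' - s) = mean s t * (t - s) + mean t t' * (t' - t)"
    by (simp add: mean_mult)
  have lt: "mean s t < mean t t'"
    using mean_between(2)[OF assms(1)] mean_between(1)[OF assms(2)] by linarith
  have "mean s t * (t' - t) < mean t t' * (t' - t)" "mean s t * (t - s) < mean t t' * (t - s)"
    using lt assms by auto
  with eq have "mean s t * (t' - s) < mean s t' * (t' - s)" "mean s t' * (t' - s) < mean t t' * (t' - s)"
    by (auto simp: algebra_simps)
  then show "mean s t < mean s t'" "mean s t' < mean t t'"
    using assms by auto
qed

lemma mean_less_mean:
  assumes "s < t" "s' < t'" "s \<le> s'" "t \<le> t'" "s \<noteq> s' \<or> t \<noteq> t'"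
  shows "mean s t < mean s' t'"
proof -
  have 1: "mean s t \<le> mean s t'"
    using mean_less(1)[of s t t'] assms by (cases "t = t'") auto
  have 2: "mean s t' \<le> mean s' t'"
    using mean_less(2)[of s s' t'] assms by (cases "s = s'") auto
  show ?thesis
  proof (cases "t = t'")
    case True
    then show ?thesis using mean_less(2)[of s s' t'] assms 1 by auto
  next
    case False
    then show ?thesis using mean_less(1)[of s t t'] assms 2 by auto
  qed
qed

lemma mean_min_max: "min (\<phi> s) (\<phi> t) \<le> mean s t" "mean s t \<le> max (\<phi> s) (\<phi> t)"
proof -
  consider "s = t" | "s < t" | "t < s" by linarith
  then have "min (\<phi> s) (\<phi> t) \<le> mean s t \<and> mean s t \<le> max (\<phi> s) (\<phi> t)"
  proof cases
    case 2 then show ?thesis using mean_between[of s t] by auto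
  next
    case 3 then show ?thesis using mean_between[of t s] by (auto simp: mean_commute[of s])
  qed auto
  then show "min (\<phi> s) (\<phi> t) \<le> mean s t" "mean s t \<le> max (\<phi> s) (\<phi> t)" by auto
qed

lemma continuous_on_mean [continuous_intros]:
  fixes f g :: "'a::t2_space \<Rightarrow> real"
  assumes "continuous_on S f" "continuous_on S g"
  shows "continuous_on S (\<lambda>x. mean (f x) (g x))"
proof -
  have fg: "(f \<longlongrightarrow> f x) (at x within S)" "(g \<longlongrightarrow> g x) (at x within S)" if "x \<in> S" for x
    using assms that by (auto simp: continuous_on_def)
  have \<phi>: "isCont \<phi> x" and P: "isCont prim x" for x
    using cont isCont_prim by (auto simp: continuous_on_eq_continuous_at)
  have "((\<lambda>x. mean (f x) (g x)) \<longlongrightarrow> mean (f x) (g x)) (at x within S)" if "x \<in> S" for x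
  proof (cases "f x = g x")
    case True
    have l: "((\<lambda>x. \<phi> (f x)) \<longlongrightarrow> \<phi> (f x)) (at x within S)"
      "((\<lambda>x. \<phi> (g x)) \<longlongrightarrow> \<phi> (f x)) (at x within S)"
      using isCont_tendsto_compose[OF \<phi> fg(1)[OF that]]
        isCont_tendsto_compose[OF \<phi> fg(2)[OF that]] True by auto
    have m: "((\<lambda>x. min (\<phi> (f x)) (\<phi> (g x))) \<longlongrightarrow> \<phi> (f x)) (at x within S)"
      "((\<lambda>x. max (\<phi> (f x)) (\<phi> (g x))) \<longlongrightarrow> \<phi> (f x)) (at x within S)"
      using tendsto_min[OF l] tendsto_max[OF l] by auto
    have e: "\<forall>\<^sub>F x in at x within S. min (\<phi> (f x)) (\<phi> (g x)) \<le> mean (f x) (g x)"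
      "\<forall>\<^sub>F x in at x within S. mean (f x) (g x) \<le> max (\<phi> (f x)) (\<phi> (g x))"
      using mean_min_max by (auto intro!: always_eventually)
    show ?thesis using tendsto_sandwich[OF e m] True by simp
  next
    case False
    have "((\<lambda>x. g x - f x) \<longlongrightarrow> g x - f x) (at x within S)"
      using fg[OF that] by (intro tendsto_diff)
    then have ev: "\<forall>\<^sub>F x in at x within S. g x - f x \<noteq> 0"
      using False by (intro tendsto_imp_eventually_ne) auto
    have "((\<lambda>x. (prim (g x) - prim (f x)) / (g x - f x)) \<longlongrightarrow> mean (f x) (g x)) (at x within S)"
      unfolding mean_def using False fg[OF that]
      by (simp add: tendsto_divide tendsto_diff isCont_tendsto_compose[OF P])
    then show ?thesis
      by (rule Lim_transform_eventually) (use ev in eventually_elim, auto simp: mean_def)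
  qed
  then show ?thesis by (simp add: continuous_on_def)
qed

lemma mean_deriv:
  assumes f: "(f has_derivative f') (at x)" and g: "(g has_derivative g') (at x)"
    and ne: "f x \<noteq> g x"
  shows "((\<lambda>x. mean (f x) (g x)) has_derivative
    (\<lambda>e. ((\<phi> (g x) - mean (f x) (g x)) * g' e + (mean (f x) (g x) - \<phi> (f x)) * f' e) / (g x - f x)))
    (at x)"
proof -
  have P: "((\<lambda>x. prim (u x)) has_derivative (\<lambda>e. \<phi> (u x) * u' e)) (at x)"
    if "(u has_derivative u') (at x)" for u u'
    using has_derivative_compose[OF that, of prim "\<lambda>e. \<phi> (u x) * e"] prim_deriv[of "u x"]
    by (simp add: has_field_derivative_def)
  have d: "((\<lambda>x. (prim (g x) - prim (f x)) / (g x - f x)) has_derivative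
    (\<lambda>e. ((\<phi> (g x) - mean (f x) (g x)) * g' e + (mean (f x) (g x) - \<phi> (f x)) * f' e) / (g x - f x)))
    (at x)"
  proof (rule has_derivative_eq_rhs)
    show "((\<lambda>x. (prim (g x) - prim (f x)) / (g x - f x)) has_derivative
      (\<lambda>h. - (prim (g x) - prim (f x)) * (inverse (g x - f x) * (g' h - f' h) * inverse (g x - f x)) +
          (\<phi> (g x) * g' h - \<phi> (f x) * f' h) / (g x - f x))) (at x)"
      by (intro has_derivative_divide has_derivative_diff P f g) (use ne in auto)
    show "(\<lambda>h. - (prim (g x) - prim (f x)) * (inverse (g x - f x) * (g' h - f' h) * inverse (g x - f x)) +
          (\<phi> (g x) * g' h - \<phi> (f x) * f' h) / (g x - f x)) =
      (\<lambda>e. ((\<phi> (g x) - mean (f x) (g x)) * g' e + (mean (f x) (g x) - \<phi> (f x)) * f' e) / (g x - f x))"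
      unfolding mean_mult[of "f x" "g x", symmetric]
      using ne by (auto simp: fun_eq_iff divide_simps) (simp add: algebra_simps)
  qed
  have "continuous (at x) (\<lambda>x. g x - f x)"
    using f g by (intro continuous_intros has_derivative_continuous)
  then have ev: "\<forall>\<^sub>F x in at x. g x - f x \<noteq> 0"
    using ne by (intro tendsto_imp_eventually_ne) (auto simp: continuous_within)
  have ev': "\<forall>\<^sub>F x in at x. (prim (g x) - prim (f x)) / (g x - f x) = mean (f x) (g x)"
    by (use ev in eventually_elim, auto simp: mean_def)
  show ?thesis
    by (rule has_derivative_transform_eventually[OF d ev']) (use ne in \<open>auto simp: mean_def\<close>)
qed

end

section \<open>The Beurling--Ahlfors map of the half-plane\<close>

context circle_lift
begin

definition rmean :: "complex \<Rightarrow> real" where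
  "rmean w = mean (Re w) (Re w + Im w)"

definition lmean :: "complex \<Rightarrow> real" where
  "lmean w = mean (Re w - Im w) (Re w)"

text \<open>The Beurling--Ahlfors extension of \<open>\<phi>\<close>, given for all \<open>w\<close> and meant for \<open>Im w \<ge> 0\<close>.\<close>

definition BA :: "complex \<Rightarrow> complex" where
  "BA w = Complex ((rmean w + lmean w) / 2) (rmean w - lmean w)"

lemma BA_real: "Im w = 0 \<Longrightarrow> BA w = of_real (\<phi> (Re w))"
  by (simp add: BA_def rmean_def lmean_def complex_eq_iff)

lemma Im_BA_pos: "Im w > 0 \<Longrightarrow> Im (BA w) > 0"
  using mean_between(1)[of "Re w" "Re w + Im w"] mean_between(2)[of "Re w - Im w" "Re w"]
  by (simp add: BA_def rmean_def lmean_def)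

lemma BA_period: "BA (w + 2 * of_real pi) = BA w + 2 * of_real pi"
proof -
  have "rmean (w + 2 * pi) = rmean w + 2 * pi" "lmean (w + 2 * pi) = lmean w + 2 * pi"
    using mean_period[of "Re w" "Re w + Im w"] mean_period[of "Re w - Im w" "Re w"]
    by (simp_all add: rmean_def lmean_def algebra_simps)
  then show ?thesis by (simp add: BA_def complex_eq_iff)
qed

lemma BA_period_int: "BA (w + 2 * of_real pi * of_int n) = BA w + 2 * of_real pi * of_int n"
proof (induction n rule: int_induct[where k = 0])
  case (step1 i)
  then show ?case using BA_period[of "w + 2 * of_real pi * of_int i"] by (simp add: algebra_simps)
next
  case (step2 i)
  then show ?case using BA_period[of "w + 2 * of_real pi * of_int (i - 1)"] by (simp add: algebra_simps)
qed simp

lemma continuous_on_BA: "continuous_on S BA"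
  unfolding BA_def rmean_def lmean_def Complex_eq by (intro continuous_intros) auto

text \<open>If the centre moves to the right while both means are kept, monotonicity of the means forces
  both outer end points to move to the left. Then the right interval gets shorter and the left one
  longer, although both have length \<open>Im w\<close>.\<close>

lemma Re_le_of_means_eq:
  assumes "Im w > 0" "Im w' > 0" "rmean w = rmean w'" "lmean w = lmean w'"
  shows "Re w \<ge> Re w'"
proof (rule ccontr)
  assume "\<not> Re w \<ge> Re w'"
  then have lt: "Re w < Re w'" by simp
  have "Re w' + Im w' < Re w + Im w"
  proof (rule ccontr)
    assume "\<not> Re w' + Im w' < Re w + Im w"
    then have "mean (Re w) (Re w + Im w) < mean (Re w') (Re w' + Im w')"
      using lt assms by (intro mean_less_mean) auto
    with assms show False by (simp add: rmean_def)
  qed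
  moreover have "Re w' - Im w' < Re w - Im w"
  proof (rule ccontr)
    assume "\<not> Re w' - Im w' < Re w - Im w"
    then have "mean (Re w - Im w) (Re w) < mean (Re w' - Im w') (Re w')"
      using lt assms by (intro mean_less_mean) auto
    with assms show False by (simp add: lmean_def)
  qed
  ultimately show False using lt by linarith
qed

lemma BA_inj:
  assumes "Im w > 0" "Im w' > 0" "BA w = BA w'"
  shows "w = w'"
proof -
  have m: "rmean w = rmean w'" "lmean w = lmean w'"
    using assms(3) by (auto simp: BA_def)
  have re: "Re w = Re w'"
    using Re_le_of_means_eq[OF assms(1,2) m] Re_le_of_means_eq[OF assms(2,1)] m by auto
  have "Im w = Im w'"
  proof (rule ccontr)
    assume ne: "Im w \<noteq> Im w'"
    then consider "Im w < Im w'" | "Im w' < Im w" by linarith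
    then show False
    proof cases
      case 1 then show ?thesis
        using mean_less(1)[of "Re w" "Re w + Im w" "Re w + Im w'"] assms m(1) re
        by (auto simp: rmean_def)
    next
      case 2 then show ?thesis
        using mean_less(1)[of "Re w" "Re w + Im w'" "Re w + Im w"] assms m(1) re
        by (auto simp: rmean_def)
    qed
  qed
  with re show ?thesis by (simp add: complex_eq_iff)
qed

text \<open>The partial derivatives of \<open>BA\<close> in the real and the imaginary direction.\<close>

definition BAx :: "complex \<Rightarrow> complex" where
  "BAx w = (let x = Re w; y = Im w; \<alpha> = \<phi> (x + y) - \<phi> x; \<beta> = \<phi> x - \<phi> (x - y)
    in Complex ((\<alpha> + \<beta>) / (2 * y)) ((\<alpha> - \<beta>) / y))"

definition BAy :: "complex \<Rightarrow> complex" where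
  "BAy w = (let x = Re w; y = Im w; \<alpha>' = \<phi> (x + y) - rmean w; \<beta>' = lmean w - \<phi> (x - y)
    in Complex ((\<alpha>' - \<beta>') / (2 * y)) ((\<alpha>' + \<beta>') / y))"

lemma BA_deriv:
  assumes "Im w > 0"
  shows "(BA has_derivative (\<lambda>e. Re e *\<^sub>R BAx w + Im e *\<^sub>R BAy w)) (at w)"
proof -
  define x y where "x = Re w" and "y = Im w"
  have re: "(Re has_derivative Re) (at w)" and im: "(Im has_derivative Im) (at w)"
    by (auto intro!: bounded_linear_imp_has_derivative bounded_linear_Re bounded_linear_Im)
  have r: "(rmean has_derivative
    (\<lambda>e. ((\<phi> (x + y) - \<phi> x) * Re e + (\<phi> (x + y) - rmean w) * Im e) / y)) (at w)"
    using mean_deriv[OF re has_derivative_add[OF re im]] assms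
    unfolding rmean_def x_def y_def by (simp add: algebra_simps)
  have l: "(lmean has_derivative
    (\<lambda>e. ((\<phi> x - \<phi> (x - y)) * Re e - (lmean w - \<phi> (x - y)) * Im e) / y)) (at w)"
    using mean_deriv[OF has_derivative_diff[OF re im] re] assms
    unfolding lmean_def x_def y_def by (simp add: algebra_simps)
  have BA: "BA = (\<lambda>w. rmean w *\<^sub>R Complex (1 / 2) 1 + lmean w *\<^sub>R Complex (1 / 2) (- 1))"
    by (auto simp: BA_def fun_eq_iff complex_eq_iff)
  show ?thesis unfolding BA
    by (rule has_derivative_eq_rhs[OF has_derivative_add[OF has_derivative_scaleR_left[OF r]
          has_derivative_scaleR_left[OF l]]])
       (use assms in \<open>auto simp: fun_eq_iff complex_eq_iff BAx_def BAy_def Let_def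
          x_def[symmetric] y_def[symmetric] field_simps\<close>)
qed

lemma BAx_period: "BAx (w + 2 * of_real pi) = BAx w"
  using period[of "Re w + Im w"] period[of "Re w"] period[of "Re w - Im w"]
  by (simp add: BAx_def Let_def algebra_simps)

lemma BAy_period: "BAy (w + 2 * of_real pi) = BAy w"
  using period[of "Re w + Im w"] period[of "Re w"] period[of "Re w - Im w"]
    mean_period[of "Re w" "Re w + Im w"] mean_period[of "Re w - Im w" "Re w"]
  by (simp add: BAy_def rmean_def lmean_def Let_def algebra_simps)

lemma continuous_on_BAx: "continuous_on {w. Im w > 0} BAx"
  unfolding BAx_def Let_def Complex_eq by (intro continuous_intros) auto

lemma continuous_on_BAy: "continuous_on {w. Im w > 0} BAy"
  unfolding BAy_def Let_def Complex_eq rmean_def lmean_def by (intro continuous_intros) auto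

text \<open>The function \<open>prim x - x\<^sup>2 / 2 - \<phi> 0 * x\<close> has derivative \<open>\<phi> x - x - \<phi> 0\<close>, which is at most \<open>2\<pi>\<close> in
  absolute value.\<close>

lemma mean_approx: "\<bar>mean s t - (s + t) / 2 - \<phi> 0\<bar> \<le> 2 * pi"
proof -
  have b: "\<bar>\<phi> x - x - \<phi> 0\<bar> \<le> 2 * pi" for x
    using increment_bounds[of 0 x] increment_bounds[of x 0] by (cases "0 \<le> x") auto
  have *: "\<bar>mean s t - (s + t) / 2 - \<phi> 0\<bar> \<le> 2 * pi" if lt: "s < t" for s t
  proof -
    let ?f = "\<lambda>x. prim x - x\<^sup>2 / 2 - \<phi> 0 * x"
    have "(?f has_real_derivative \<phi> x - x - \<phi> 0) (at x)" for x
      by (auto intro!: derivative_eq_intros)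
    then obtain z where "?f t - ?f s = (t - s) * (\<phi> z - z - \<phi> 0)"
      using MVT2[OF lt, of ?f "\<lambda>x. \<phi> x - x - \<phi> 0"] by blast
    then have "mean s t = (s + t) / 2 + \<phi> 0 + (\<phi> z - z - \<phi> 0)"
      using lt by (simp add: mean_def field_simps power2_eq_square)
    then show ?thesis using b[of z] by simp
  qed
  show ?thesis
    using *[of s t] *[of t s] b[of s] by (cases s t rule: linorder_cases) (auto simp: mean_commute[of t] add.commute)
qed

text \<open>This makes the extension to the disk at most linear at the origin, hence continuous there
  with a bounded difference quotient.\<close>

lemma Im_BA_ge: "Im (BA w) \<ge> Im w - 4 * pi"
  using mean_approx[of "Re w" "Re w + Im w"] mean_approx[of "Re w - Im w" "Re w"]
  by (simp add: BA_def rmean_def lmean_def field_simps abs_le_iff)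

text \<open>The symmetric distortion of the lift. It agrees with \<open>rho_c\<close> as long as both arcs together are
  shorter than the circle, but it makes sense at all scales.\<close>

definition sym_dist :: "real \<Rightarrow> real \<Rightarrow> real" where
  "sym_dist x t = max ((\<phi> (x + t) - \<phi> x) / (\<phi> x - \<phi> (x - t)))
                   ((\<phi> x - \<phi> (x - t)) / (\<phi> (x + t) - \<phi> x))"

lemma sym_dist_ge:
  assumes "t > 0"
  shows "\<phi> (x + t) - \<phi> x \<le> sym_dist x t * (\<phi> x - \<phi> (x - t))"
    and "\<phi> x - \<phi> (x - t) \<le> sym_dist x t * (\<phi> (x + t) - \<phi> x)"
proof -
  have pos: "\<phi> (x + t) - \<phi> x > 0" "\<phi> x - \<phi> (x - t) > 0" using assms by auto
  have "(\<phi> (x + t) - \<phi> x) / (\<phi> x - \<phi> (x - t)) \<le> sym_dist x t"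
    "(\<phi> x - \<phi> (x - t)) / (\<phi> (x + t) - \<phi> x) \<le> sym_dist x t"
    by (auto simp: sym_dist_def)
  with pos show "\<phi> (x + t) - \<phi> x \<le> sym_dist x t * (\<phi> x - \<phi> (x - t))"
    "\<phi> x - \<phi> (x - t) \<le> sym_dist x t * (\<phi> (x + t) - \<phi> x)"
    by (metis pos_divide_le_eq)+
qed

lemma sym_dist_ge_1:
  assumes "t > 0" shows "sym_dist x t \<ge> 1"
proof -
  have "1 \<le> max (r / s) (s / r)" if "r > 0" "s > 0" for r s :: real
    using that by (cases "r \<le> s") (auto simp: le_max_iff_disj)
  then show ?thesis using assms by (simp add: sym_dist_def)
qed

text \<open>The symmetric distortions at \<open>(x, y)\<close> and \<open>(x \<plusminus> y / 3, 2 y / 3)\<close>, which jointly control the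
  dilatation of \<open>BA\<close> at \<open>x + i y\<close>.\<close>

definition sym_dist3 :: "complex \<Rightarrow> real" where
  "sym_dist3 w = max (sym_dist (Re w) (Im w))
     (max (sym_dist (Re w - Im w / 3) (2 * Im w / 3)) (sym_dist (Re w + Im w / 3) (2 * Im w / 3)))"

text \<open>On a third of the interval \<open>\<phi>\<close> differs from its extreme value by at least the left-hand side, and on
  the rest the difference has the same sign.\<close>

lemma mean_thirds:
  assumes "y > 0"
  shows "\<phi> (x + y) - \<phi> (x + y / 3) \<le> 3 * (\<phi> (x + y) - mean x (x + y))"
    and "\<phi> (x - y / 3) - \<phi> (x - y) \<le> 3 * (mean (x - y) x - \<phi> (x - y))"
proof -
  have "mean x (x + y) * y = mean x (x + y / 3) * (y / 3) + mean (x + y / 3) (x + y) * (2 * y / 3)"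
    using mean_mult[of x "x + y"] mean_mult[of x "x + y / 3"] mean_mult[of "x + y / 3" "x + y"]
    by (simp add: field_simps)
  also have "\<dots> \<le> \<phi> (x + y / 3) * (y / 3) + \<phi> (x + y) * (2 * y / 3)"
    using mean_between(2)[of x "x + y / 3"] mean_between(2)[of "x + y / 3" "x + y"] assms
    by (intro add_mono mult_right_mono) auto
  finally have "mean x (x + y) * y \<le> (\<phi> (x + y / 3) / 3 + \<phi> (x + y) * (2 / 3)) * y"
    by (simp add: algebra_simps)
  then show "\<phi> (x + y) - \<phi> (x + y / 3) \<le> 3 * (\<phi> (x + y) - mean x (x + y))"
    using assms by simp
  have "mean (x - y) x * y = mean (x - y) (x - y / 3) * (2 * y / 3) + mean (x - y / 3) x * (y / 3)"
    using mean_mult[of "x - y" x] mean_mult[of "x - y" "x - y / 3"] mean_mult[of "x - y / 3" x]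
    by (simp add: field_simps)
  also have "\<dots> \<ge> \<phi> (x - y) * (2 * y / 3) + \<phi> (x - y / 3) * (y / 3)"
    using mean_between(1)[of "x - y" "x - y / 3"] mean_between(1)[of "x - y / 3" x] assms
    by (intro add_mono mult_right_mono) auto
  finally have "(\<phi> (x - y) * (2 / 3) + \<phi> (x - y / 3) / 3) * y \<le> mean (x - y) x * y"
    by (simp add: algebra_simps)
  then show "\<phi> (x - y / 3) - \<phi> (x - y) \<le> 3 * (mean (x - y) x - \<phi> (x - y))"
    using assms by simp
qed

text \<open>Here \<open>m\<close> stands for the increment over the outer two thirds on the side of the larger increment
  \<open>\<alpha>\<close>, and \<open>n\<close> for that over the outer two thirds on the other side. Either \<open>\<alpha>'\<close> is comparable to
  \<open>\<alpha>\<close> and the product \<open>\<alpha>' \<beta>\<close> is large enough, or the inner third carries half of \<open>\<alpha>\<close> and \<open>\<alpha> \<beta>'\<close> is.\<close>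

lemma distortion_bound_of_thirds:
  fixes \<alpha> \<beta> \<alpha>' \<beta>' M m n :: real
  assumes ab: "0 < \<beta>" "\<beta> \<le> \<alpha>" "0 \<le> \<alpha>'" "0 \<le> \<beta>'" "0 \<le> M"
    and 1: "\<alpha> \<le> M * \<beta>"
    and 2: "m \<le> 3 * \<alpha>'" and 3: "n \<le> 3 * \<beta>'"
    and 4: "\<alpha> - m \<le> M * n"
  shows "5 / 2 * (\<alpha> + \<beta>)\<^sup>2 \<le> 60 * M * (\<alpha> * \<beta>' + \<alpha>' * \<beta>)"
proof -
  have "5 / 2 * (\<alpha> + \<beta>)\<^sup>2 \<le> 5 / 2 * (2 * \<alpha>)\<^sup>2"
    using ab by (intro mult_left_mono power_mono) auto
  also have "\<dots> = 60 * (\<alpha> * (\<alpha> / 6))" by (simp add: power2_eq_square)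
  also have "\<alpha> * (\<alpha> / 6) \<le> M * (\<alpha> * \<beta>' + \<alpha>' * \<beta>)"
  proof (cases "\<alpha>' \<ge> \<alpha> / 6")
    case True
    have "\<alpha> * (\<alpha> / 6) \<le> (M * \<beta>) * \<alpha>'"
      using True 1 ab by (intro mult_mono) auto
    also have "\<dots> \<le> M * (\<alpha> * \<beta>' + \<alpha>' * \<beta>)" using ab by (simp add: algebra_simps)
    finally show ?thesis .
  next
    case False
    have "M * n \<le> M * (3 * \<beta>')" using 3 ab by (intro mult_left_mono) auto
    then have "\<alpha> / 6 \<le> M * \<beta>'" using False 2 4 by linarith
    then have "\<alpha> * (\<alpha> / 6) \<le> \<alpha> * (M * \<beta>')" using ab by (intro mult_left_mono) auto
    also have "\<dots> \<le> M * (\<alpha> * \<beta>' + \<alpha>' * \<beta>)" using ab by (simp add: algebra_simps)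
    finally show ?thesis .
  qed
  finally show ?thesis by (simp add: algebra_simps)
qed

text \<open>The first bound is the linear estimate for the dilatation, since \<open>Im (cnj (BAx w) * BAy w)\<close> is
  the Jacobian; the second one keeps the derivative bounded away from the real axis.\<close>

lemma BA_distortion:
  assumes "Im w > 0"
  shows "(norm (BAx w))\<^sup>2 + (norm (BAy w))\<^sup>2 \<le> 60 * sym_dist3 w * Im (cnj (BAx w) * BAy w)"
    and "(norm (BAx w))\<^sup>2 + (norm (BAy w))\<^sup>2 \<le> 5 / 2 * (2 + 4 * pi / Im w)\<^sup>2"
proof -
  define x y where "x = Re w" and "y = Im w"
  define \<alpha> \<beta> \<alpha>' \<beta>' where "\<alpha> = \<phi> (x + y) - \<phi> x" and "\<beta> = \<phi> x - \<phi> (x - y)"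
    and "\<alpha>' = \<phi> (x + y) - rmean w" and "\<beta>' = lmean w - \<phi> (x - y)"
  have y: "y > 0" using assms by (simp add: y_def)
  have pos: "0 < \<alpha>" "0 < \<beta>" "0 \<le> \<alpha>'" "0 \<le> \<beta>'" "\<alpha>' \<le> \<alpha>" "\<beta>' \<le> \<beta>"
    using mean_between[of x "x + y"] mean_between[of "x - y" x] y
    by (auto simp: \<alpha>_def \<beta>_def \<alpha>'_def \<beta>'_def rmean_def lmean_def x_def y_def)
  have X: "BAx w = Complex ((\<alpha> + \<beta>) / (2 * y)) ((\<alpha> - \<beta>) / y)"
    and Y: "BAy w = Complex ((\<alpha>' - \<beta>') / (2 * y)) ((\<alpha>' + \<beta>') / y)"
    by (simp_all add: BAx_def BAy_def Let_def \<alpha>_def \<beta>_def \<alpha>'_def \<beta>'_def x_def y_def)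
  have det: "Im (cnj (BAx w) * BAy w) = (\<alpha> * \<beta>' + \<alpha>' * \<beta>) / y\<^sup>2"
    using y by (simp add: X Y field_simps power2_eq_square)
  have sq: "(norm (BAx w))\<^sup>2 + (norm (BAy w))\<^sup>2 \<le> 5 / 2 * (\<alpha> + \<beta>)\<^sup>2 / y\<^sup>2"
  proof -
    have a: "(\<alpha> - \<beta>)\<^sup>2 \<le> (\<alpha> + \<beta>)\<^sup>2" "(\<alpha>' - \<beta>')\<^sup>2 \<le> (\<alpha> + \<beta>)\<^sup>2" "(\<alpha>' + \<beta>')\<^sup>2 \<le> (\<alpha> + \<beta>)\<^sup>2"
      using pos by (auto simp: abs_le_square_iff[symmetric])
    have "(norm (BAx w))\<^sup>2 + (norm (BAy w))\<^sup>2 =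
      ((\<alpha> + \<beta>)\<^sup>2 / 4 + (\<alpha> - \<beta>)\<^sup>2 + (\<alpha>' - \<beta>')\<^sup>2 / 4 + (\<alpha>' + \<beta>')\<^sup>2) / y\<^sup>2"
      unfolding X Y cmod_power2 complex.sel power_divide power_mult_distrib
      by (simp add: add_divide_distrib)
    also have "\<dots> \<le> (5 / 2 * (\<alpha> + \<beta>)\<^sup>2) / y\<^sup>2"
      using a by (intro divide_right_mono) auto
    finally show ?thesis by simp
  qed
  have L: "sym_dist x y \<le> sym_dist3 w" "sym_dist (x - y / 3) (2 * y / 3) \<le> sym_dist3 w"
    "sym_dist (x + y / 3) (2 * y / 3) \<le> sym_dist3 w"
    by (auto simp: sym_dist3_def x_def y_def)
  have M: "0 \<le> sym_dist3 w" using sym_dist_ge_1[OF y, of x] L(1) by linarith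
  have q: "\<phi> (x + y) - \<phi> (x + y / 3) \<le> 3 * \<alpha>'" "\<phi> (x - y / 3) - \<phi> (x - y) \<le> 3 * \<beta>'"
    using mean_thirds[OF y] by (auto simp: \<alpha>'_def \<beta>'_def rmean_def lmean_def x_def y_def)
  have r0: "\<alpha> \<le> sym_dist x y * \<beta>" "\<beta> \<le> sym_dist x y * \<alpha>"
    using sym_dist_ge[OF y, of x] by (auto simp flip: \<alpha>_def \<beta>_def)
  have r: "\<alpha> \<le> sym_dist3 w * \<beta>" "\<beta> \<le> sym_dist3 w * \<alpha>"
    using order_trans[OF r0(1) mult_right_mono[OF L(1)]] order_trans[OF r0(2) mult_right_mono[OF L(1)]]
      pos by auto
  have shift: "x - y / 3 + 2 * y / 3 = x + y / 3" "x - y / 3 - 2 * y / 3 = x - y"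
    "x + y / 3 + 2 * y / 3 = x + y" "x + y / 3 - 2 * y / 3 = x - y / 3" by auto
  have "5 / 2 * (\<alpha> + \<beta>)\<^sup>2 \<le> 60 * sym_dist3 w * (\<alpha> * \<beta>' + \<alpha>' * \<beta>)"
  proof (cases "\<beta> \<le> \<alpha>")
    case True
    have "\<phi> (x + y / 3) - \<phi> (x - y / 3) \<le> sym_dist (x - y / 3) (2 * y / 3) * (\<phi> (x - y / 3) - \<phi> (x - y))"
      using sym_dist_ge(1)[of "2 * y / 3" "x - y / 3"] y unfolding shift by simp
    also have "\<dots> \<le> sym_dist3 w * (\<phi> (x - y / 3) - \<phi> (x - y))"
      using L(2) y by (intro mult_right_mono) auto
    finally have "\<alpha> - (\<phi> (x + y) - \<phi> (x + y / 3)) \<le> sym_dist3 w * (\<phi> (x - y / 3) - \<phi> (x - y))"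
      using y le_iff[of "x - y / 3" x] unfolding \<alpha>_def by linarith
    then show ?thesis by (intro distortion_bound_of_thirds[OF pos(2) True pos(3,4) M r(1) q])
  next
    case False
    have "\<phi> (x + y / 3) - \<phi> (x - y / 3) \<le> sym_dist (x + y / 3) (2 * y / 3) * (\<phi> (x + y) - \<phi> (x + y / 3))"
      using sym_dist_ge(2)[of "2 * y / 3" "x + y / 3"] y unfolding shift by simp
    also have "\<dots> \<le> sym_dist3 w * (\<phi> (x + y) - \<phi> (x + y / 3))"
      using L(3) y by (intro mult_right_mono) auto
    finally have "\<beta> - (\<phi> (x - y / 3) - \<phi> (x - y)) \<le> sym_dist3 w * (\<phi> (x + y) - \<phi> (x + y / 3))"
      using y le_iff[of x "x + y / 3"] unfolding \<beta>_def by linarith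
    then have "5 / 2 * (\<beta> + \<alpha>)\<^sup>2 \<le> 60 * sym_dist3 w * (\<beta> * \<alpha>' + \<beta>' * \<alpha>)"
      using False by (intro distortion_bound_of_thirds[OF pos(1) _ pos(4,3) M r(2) q(2,1)]) auto
    then show ?thesis by (simp add: algebra_simps)
  qed
  then have "5 / 2 * (\<alpha> + \<beta>)\<^sup>2 / y\<^sup>2 \<le> 60 * sym_dist3 w * (\<alpha> * \<beta>' + \<alpha>' * \<beta>) / y\<^sup>2"
    by (intro divide_right_mono) auto
  with sq show "(norm (BAx w))\<^sup>2 + (norm (BAy w))\<^sup>2 \<le> 60 * sym_dist3 w * Im (cnj (BAx w) * BAy w)"
    unfolding det by simp
  have "\<alpha> + \<beta> \<le> 2 * y + 4 * pi"
    using increment_bounds(1)[of x "x + y"] increment_bounds(1)[of "x - y" x] y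
    by (simp add: \<alpha>_def \<beta>_def)
  then have "(\<alpha> + \<beta>) / y \<le> (2 * y + 4 * pi) / y" using y by (intro divide_right_mono) auto
  then have "(\<alpha> + \<beta>) / y \<le> 2 + 4 * pi / y" using y by (simp add: add_divide_distrib)
  then have "((\<alpha> + \<beta>) / y)\<^sup>2 \<le> (2 + 4 * pi / y)\<^sup>2" using pos y by (intro power_mono) auto
  with sq show "(norm (BAx w))\<^sup>2 + (norm (BAy w))\<^sup>2 \<le> 5 / 2 * (2 + 4 * pi / Im w)\<^sup>2"
    by (simp add: y_def power_divide)
qed

text \<open>By periodicity the increments over intervals of length \<open>\<pi> / 3\<close> are bounded below, and those over
  long intervals are comparable to the length.\<close>

lemma sym_dist_bounded: "\<exists>M. \<forall>x t. t \<ge> pi / 3 \<longrightarrow> sym_dist x t \<le> M"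
proof -
  have "\<exists>d>0. \<forall>x. d \<le> \<phi> (x + pi / 3) - \<phi> x"
  proof -
    have c: "continuous_on {0..2 * pi} (\<lambda>x. \<phi> (x + pi / 3) - \<phi> x)" by (intro continuous_intros)
    obtain z where z: "z \<in> {0..2 * pi}"
      "\<And>x. x \<in> {0..2 * pi} \<Longrightarrow> \<phi> (z + pi / 3) - \<phi> z \<le> \<phi> (x + pi / 3) - \<phi> x"
      using continuous_attains_inf[OF _ _ c] by (auto simp: Ball_def)
    have "\<phi> (z + pi / 3) - \<phi> z \<le> \<phi> (x + pi / 3) - \<phi> x" for x
    proof -
      define n where "n = \<lfloor>x / (2 * pi)\<rfloor>"
      have "x - 2 * pi * of_int n \<in> {0..2 * pi}"
        using floor_correct[of "x / (2 * pi)"] unfolding n_def[symmetric] by (auto simp: field_simps)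
      from z(2)[OF this] show ?thesis
        using period_int[of "x - 2 * pi * of_int n" n] period_int[of "x - 2 * pi * of_int n + pi / 3" n]
        by (simp add: algebra_simps)
    qed
    then show ?thesis by (intro exI[of _ "\<phi> (z + pi / 3) - \<phi> z"]) simp
  qed
  then obtain d where d: "d > 0" "\<And>x. d \<le> \<phi> (x + pi / 3) - \<phi> x" by blast
  define M where "M = max 3 (6 * pi / d)"
  have *: "(\<phi> b - \<phi> a) / (\<phi> b' - \<phi> a') \<le> M" if "b - a = t" "b' - a' = t" "t \<ge> pi / 3" for a b a' b' t
  proof -
    have t: "t > 0" using that(3) pi_gt_zero by linarith
    have num: "\<phi> b - \<phi> a \<le> t + 2 * pi" using increment_bounds[of a b] that t by simp
    have den: "t - 2 * pi \<le> \<phi> b' - \<phi> a'" using increment_bounds[of a' b'] that t by simp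
    have "\<phi> (a' + pi / 3) \<le> \<phi> b'" using that by simp
    with d(2)[of a'] have den2: "d \<le> \<phi> b' - \<phi> a'" by linarith
    show ?thesis
    proof (cases "t \<le> 4 * pi")
      case True
      have "(\<phi> b - \<phi> a) / (\<phi> b' - \<phi> a') \<le> (6 * pi) / d"
        using num den2 d(1) True by (intro frac_le) auto
      then show ?thesis by (simp add: M_def)
    next
      case False
      have "(\<phi> b - \<phi> a) / (\<phi> b' - \<phi> a') \<le> 3"
        unfolding pos_divide_le_eq[OF less_le_trans[OF d(1) den2]] using num den False by argo
      then show ?thesis by (simp add: M_def)
    qed
  qed
  have "sym_dist x t \<le> M" if "t \<ge> pi / 3" for x t
    using that by (auto simp: sym_dist_def intro!: *)
  then show ?thesis by blast
qed

end

section \<open>Logarithmic coordinates and the extension to the disk\<close>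

text \<open>All logarithms of \<open>z\<close> differ by periods, so a periodic function does not see the choice of the
  branch.\<close>

lemma periodic_log:
  fixes Q :: "complex \<Rightarrow> 'b"
  assumes per: "\<And>w. Q (w + 2 * of_real pi) = Q w" and w: "exp (\<i> * w) = z"
  shows "Q (- \<i> * Ln z) = Q w"
proof -
  have per_int: "Q (w + 2 * of_real pi * of_int n) = Q w" for n :: int
  proof (induction n rule: int_induct[where k = 0])
    case (step1 i)
    then show ?case using per[of "w + 2 * of_real pi * of_int i"] by (simp add: algebra_simps)
  next
    case (step2 i)
    then show ?case using per[of "w + 2 * of_real pi * of_int (i - 1)"] by (simp add: algebra_simps)
  qed simp
  have "z \<noteq> 0" using w by auto
  then have "exp (Ln z) = exp (\<i> * w)" by (simp add: w)
  then obtain n :: int where n: "Ln z = \<i> * w + of_int (2 * n) * pi * \<i>"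
    unfolding exp_eq by blast
  have "- \<i> * Ln z = w + 2 * of_real pi * of_int n"
    unfolding n by (simp add: algebra_simps)
  then show ?thesis using per_int[of n] by simp
qed

text \<open>Near \<open>z0\<close> the principal branch may be replaced by a branch that is continuous at \<open>z0\<close>.\<close>

lemma continuous_on_log:
  fixes Q :: "complex \<Rightarrow> 'b::topological_space"
  assumes per: "\<And>w. Q (w + 2 * of_real pi) = Q w"
    and cont: "continuous_on {w. Im w \<in> I} Q"
    and T: "\<And>z. z \<in> T \<Longrightarrow> z \<noteq> 0 \<and> - ln (norm z) \<in> I"
  shows "continuous_on T (\<lambda>z. Q (- \<i> * Ln z))"
  unfolding continuous_on_eq_continuous_within
proof
  fix z0 assume z0: "z0 \<in> T"
  define L where "L z = - \<i> * (Ln (z / z0) + Ln z0)" for z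
  define B where "B = ball z0 (norm z0)"
  have nz: "z0 \<noteq> 0" using T z0 by blast
  have B: "open B" "z0 \<in> B" using nz by (auto simp: B_def)
  have slit: "z / z0 \<notin> \<real>\<^sub>\<le>\<^sub>0" if "z \<in> B" for z
  proof
    assume "z / z0 \<in> \<real>\<^sub>\<le>\<^sub>0"
    then obtain r where r: "r \<le> 0" "z / z0 = of_real r" by (auto elim!: nonpos_Reals_cases)
    then have "z = of_real r * z0" using nz by (simp add: field_simps)
    then have "z0 - z = of_real (1 - r) * z0" by (simp add: algebra_simps)
    then have "norm (z0 - z) = \<bar>1 - r\<bar> * norm z0" by (metis norm_mult norm_of_real)
    then have "norm (z0 - z) = (1 - r) * norm z0" using r by simp
    then have "norm (z0 - z) \<ge> norm z0" using r by (simp add: mult_le_cancel_right1)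
    then show False using that by (simp add: B_def dist_norm)
  qed
  have cL: "continuous_on (T \<inter> B) L"
    unfolding L_def using slit nz by (intro continuous_intros) auto
  have ImL: "Im (L z) \<in> I" if "z \<in> T" for z
    using T[OF that] nz by (simp add: L_def norm_divide ln_div)
  have "continuous_on (T \<inter> B) (\<lambda>z. Q (L z))"
    by (rule continuous_on_compose2[OF cont cL]) (use ImL in auto)
  moreover have "Q (L z) = Q (- \<i> * Ln z)" if "z \<in> T \<inter> B" for z
  proof -
    have "exp (\<i> * L z) = z" using T that nz by (simp add: L_def exp_add)
    from periodic_log[of Q, OF per this] show ?thesis by simp
  qed
  ultimately have "continuous_on (T \<inter> B) (\<lambda>z. Q (- \<i> * Ln z))"
    by (metis (no_types, lifting) continuous_on_cong)
  then have "continuous (at z0 within (T \<inter> B)) (\<lambda>z. Q (- \<i> * Ln z))"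
    using z0 B by (simp add: continuous_on_eq_continuous_within)
  moreover have "at z0 within (T \<inter> B) = at z0 within T"
    using B by (intro at_within_nhd[of _ B]) auto
  ultimately show "continuous (at z0 within T) (\<lambda>z. Q (- \<i> * Ln z))" by simp
qed

text \<open>With \<open>X\<close> and \<open>Y\<close> the partial derivatives of a map \<open>F\<close>, this is the derivative of \<open>E \<circ> F \<circ> L\<close> for
  holomorphic \<open>E\<close> and \<open>L\<close> with derivatives \<open>c\<close> and \<open>d\<close>.\<close>

definition conj_map :: "complex \<Rightarrow> complex \<Rightarrow> complex \<Rightarrow> complex \<Rightarrow> complex \<Rightarrow>\<^sub>L complex" where
  "conj_map c d X Y = Blinfun (\<lambda>e. c * (Re (d * e) *\<^sub>R X + Im (d * e) *\<^sub>R Y))"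

lemma conj_map_apply [simp]: "blinfun_apply (conj_map c d X Y) e = c * (Re (d * e) *\<^sub>R X + Im (d * e) *\<^sub>R Y)"
proof -
  have "bounded_linear (\<lambda>e. c * (Re (d * e) *\<^sub>R X + Im (d * e) *\<^sub>R Y))"
    by (rule linear_conv_bounded_linear[THEN iffD1], rule linearI) (simp_all add: complex_eq_iff algebra_simps)
  then show ?thesis by (simp add: conj_map_def bounded_linear_Blinfun_apply)
qed

lemma norm_conj_map:
  "(norm (conj_map c d X Y))\<^sup>2 \<le> (norm c * norm d)\<^sup>2 * ((norm X)\<^sup>2 + (norm Y)\<^sup>2)"
proof -
  have "norm (conj_map c d X Y) \<le> norm c * norm d * sqrt ((norm X)\<^sup>2 + (norm Y)\<^sup>2)"
  proof (rule norm_blinfun_bound)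
    fix e
    have "norm (Re (d * e) *\<^sub>R X + Im (d * e) *\<^sub>R Y) \<le> \<bar>Re (d * e)\<bar> * norm X + \<bar>Im (d * e)\<bar> * norm Y"
      by (metis norm_triangle_ineq norm_scaleR)
    also have "\<dots> \<le> sqrt ((Re (d * e))\<^sup>2 + (Im (d * e))\<^sup>2) * sqrt ((norm X)\<^sup>2 + (norm Y)\<^sup>2)"
    proof (rule power2_le_imp_le)
      show "(\<bar>Re (d * e)\<bar> * norm X + \<bar>Im (d * e)\<bar> * norm Y)\<^sup>2
        \<le> (sqrt ((Re (d * e))\<^sup>2 + (Im (d * e))\<^sup>2) * sqrt ((norm X)\<^sup>2 + (norm Y)\<^sup>2))\<^sup>2"
      proof -
        have "(a * p + b * q)\<^sup>2 \<le> (a\<^sup>2 + b\<^sup>2) * (p\<^sup>2 + q\<^sup>2)" for a b p q :: real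
          using zero_le_power2[of "a * q - b * p"] by (simp add: power2_eq_square algebra_simps)
        from this[of "\<bar>Re (d * e)\<bar>" "norm X" "\<bar>Im (d * e)\<bar>" "norm Y"] show ?thesis
          by (simp add: power_mult_distrib)
      qed
    qed simp
    also have "sqrt ((Re (d * e))\<^sup>2 + (Im (d * e))\<^sup>2) = norm d * norm e"
      by (simp add: cmod_def[symmetric] norm_mult del: times_complex.sel)
    finally have "norm (Re (d * e) *\<^sub>R X + Im (d * e) *\<^sub>R Y) \<le> norm d * norm e * sqrt ((norm X)\<^sup>2 + (norm Y)\<^sup>2)" .
    then have "norm c * norm (Re (d * e) *\<^sub>R X + Im (d * e) *\<^sub>R Y)
      \<le> norm c * (norm d * norm e * sqrt ((norm X)\<^sup>2 + (norm Y)\<^sup>2))"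
      by (intro mult_left_mono) auto
    then show "norm (blinfun_apply (conj_map c d X Y) e) \<le> norm c * norm d * sqrt ((norm X)\<^sup>2 + (norm Y)\<^sup>2) * norm e"
      by (simp add: norm_mult mult_ac del: times_complex.sel)
  qed simp
  then have "(norm (conj_map c d X Y))\<^sup>2 \<le> (norm c * norm d * sqrt ((norm X)\<^sup>2 + (norm Y)\<^sup>2))\<^sup>2"
    by (intro power_mono) auto
  then show ?thesis by (simp add: power_mult_distrib)
qed

lemma jac_conj_map: "jac (conj_map c d X Y) = (norm c * norm d)\<^sup>2 * Im (cnj X * Y)"
  by (simp add: jac_def power_mult_distrib cmod_power2) (simp add: power2_eq_square algebra_simps)

lemma dilatation_le: "1 \<le> K \<Longrightarrow> (norm A)\<^sup>2 \<le> K * jac A \<Longrightarrow> dilatation A \<le> ennreal K"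
  unfolding dilatation_def by (intro INF_lower) auto

lemma circlepath_cis: "circlepath z r t = z + r *\<^sub>R cis (2 * pi * t)"
  by (simp add: circlepath cis_conv_exp mult_ac scaleR_conv_of_real)

context circle_lift
begin

text \<open>The map of the disk that is conjugate to \<open>BA\<close> under \<open>w \<mapsto> exp (i w)\<close>.\<close>

definition BAext :: "complex \<Rightarrow> complex" where
  "BAext z = (if z = 0 then 0 else exp (\<i> * BA (- \<i> * Ln z)))"

lemma BAext_0 [simp]: "BAext 0 = 0" by (simp add: BAext_def)

lemma BAext_eq_0: "BAext z = 0 \<longleftrightarrow> z = 0"
  by (simp add: BAext_def)

lemma exp_BA_period: "exp (\<i> * BA (w + 2 * of_real pi)) = exp (\<i> * BA w)"
  unfolding BA_period exp_eq by (intro exI[of _ 1]) (simp add: algebra_simps)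

lemma BAext_exp: "BAext (exp (\<i> * w)) = exp (\<i> * BA w)"
  unfolding BAext_def using periodic_log[of "\<lambda>w. exp (\<i> * BA w)", OF exp_BA_period refl] by simp

lemma BAext_cis: "BAext (cis x) = cis (\<phi> x)"
  using BAext_exp[of "of_real x"] by (simp add: BA_real cis_conv_exp)

lemma norm_BAext: "z \<noteq> 0 \<Longrightarrow> norm (BAext z) = exp (- Im (BA (- \<i> * Ln z)))"
  by (simp add: BAext_def)

lemma norm_BAext_less: "norm z < 1 \<Longrightarrow> norm (BAext z) < 1"
  using Im_BA_pos[of "- \<i> * Ln z"] by (cases "z = 0") (auto simp: norm_BAext)

lemma norm_BAext_eq:
  assumes "norm z = 1" shows "norm (BAext z) = 1"
  by (metis assms cis_Arg norm_cis norm_zero sgn_eq zero_neq_one div_by_1 of_real_1 BAext_cis)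

lemma norm_BAext_le: "norm (BAext z) \<le> exp (4 * pi) * norm z"
proof (cases "z = 0")
  case False
  have "norm (BAext z) \<le> exp (4 * pi + ln (norm z))"
    using Im_BA_ge[of "- \<i> * Ln z"] False by (simp add: norm_BAext)
  also have "\<dots> = exp (4 * pi) * norm z" using False by (simp add: exp_add)
  finally show ?thesis .
qed simp

lemma continuous_on_BAext: "continuous_on (cball 0 1) BAext"
proof -
  have "continuous_on (cball 0 1 - {0}) (\<lambda>z. exp (\<i> * BA (- \<i> * Ln z)))"
  proof (rule continuous_on_log[where Q = "\<lambda>w. exp (\<i> * BA w)" and I = "{0..}"])
    show "exp (\<i> * BA (w + 2 * of_real pi)) = exp (\<i> * BA w)" for w
      by (rule exp_BA_period)
    show "continuous_on {w. Im w \<in> {0..}} (\<lambda>w. exp (\<i> * BA w))"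
      by (intro continuous_intros continuous_on_BA)
  qed (auto simp: ln_le_zero_iff)
  then have c: "continuous_on (cball 0 1 - {0}) BAext"
    by (rule continuous_on_eq) (simp add: BAext_def)
  have "continuous (at z within cball 0 1) BAext" if z: "z \<in> cball 0 1" for z
  proof (cases "z = 0")
    case True
    have "((\<lambda>z::complex. exp (4 * pi) * norm z) \<longlongrightarrow> exp (4 * pi) * norm (0::complex)) (at 0 within cball 0 1)"
      by (rule tendsto_mult[OF tendsto_const tendsto_norm[OF tendsto_ident_at]])
    then have "(BAext \<longlongrightarrow> 0) (at 0 within cball 0 1)"
      by (intro Lim_null_comparison[OF always_eventually[OF allI[OF norm_BAext_le]]]) simp
    then show ?thesis using True by (simp add: continuous_within)
  next
    case False
    have "continuous (at z within cball 0 1 - {0}) BAext"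
      using c z False by (simp add: continuous_on_eq_continuous_within)
    moreover have "at z within cball 0 1 - {0} = at z within cball 0 1"
      using False by (intro at_within_nhd[of _ "- {0}"]) auto
    ultimately show ?thesis by simp
  qed
  then show ?thesis by (simp add: continuous_on_eq_continuous_within)
qed

text \<open>Equal values lift to values of \<open>BA\<close> that differ by a period; \<open>BA\<close> commutes with periods and is
  injective.\<close>

lemma inj_on_BAext_ball: "inj_on BAext (ball 0 1)"
proof (rule inj_onI)
  fix z z' :: complex assume z: "z \<in> ball 0 1" "z' \<in> ball 0 1" and eq: "BAext z = BAext z'"
  show "z = z'"
  proof (cases "z = 0 \<or> z' = 0")
    case True
    then show ?thesis using eq BAext_eq_0 by metis
  next
    case False
    define w w' where "w = - \<i> * Ln z" and "w' = - \<i> * Ln z'"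
    have zw: "z = exp (\<i> * w)" "z' = exp (\<i> * w')"
      using False by (auto simp: w_def w'_def)
    have pos: "Im w > 0" "Im w' > 0" using z False by (auto simp: w_def w'_def)
    have "exp (\<i> * BA w) = exp (\<i> * BA w')" using eq False by (simp add: BAext_def w_def w'_def)
    then obtain n :: int where "\<i> * BA w = \<i> * BA w' + of_int (2 * n) * pi * \<i>"
      unfolding exp_eq by blast
    then have "\<i> * BA w = \<i> * (BA w' + 2 * of_real pi * of_int n)" by (simp add: algebra_simps)
    then have "BA w = BA w' + 2 * of_real pi * of_int n" by simp
    then have e: "BA w = BA (w' + 2 * of_real pi * of_int n)" by (simp add: BA_period_int)
    have "Im (w' + 2 * of_real pi * of_int n) > 0" using pos(2) by simp
    from BA_inj[OF pos(1) this e] have "\<i> * w = \<i> * w' + of_int (2 * n) * pi * \<i>" by (simp add: algebra_simps)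
    then have "exp (\<i> * w) = exp (\<i> * w')" unfolding exp_eq by (rule exI)
    then show ?thesis by (simp only: zw)
  qed
qed

text \<open>The circle is mapped as by \<open>h\<close>. The image of the open disk is open by invariance of domain, and relatively closed in the open disk
  because the closed disk has compact image and the circle is mapped to itself. Hence it is the
  whole open disk.\<close>

lemma disk_extension_BAext:
  assumes h: "homeomorphism (sphere 0 1) (sphere 0 1) h g" and lift: "\<And>x. h (cis x) = cis (\<phi> x)"
  shows "disk_extension h BAext" "inj_on BAext (cball 0 1)" "\<exists>G. homeomorphism (ball 0 1) (ball 0 1) BAext G"
proof -
  have cb: "cball (0::complex) 1 = ball 0 1 \<union> sphere 0 1" by auto
  have eq: "BAext z = h z" if "z \<in> sphere 0 1" for z
  proof -
    have "z \<noteq> 0" "norm z = 1" using that by auto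
    then have "z = cis (Arg z)" using cis_Arg[of z] by (simp add: sgn_eq)
    then show ?thesis using BAext_cis lift by metis
  qed
  have "inj_on h (sphere 0 1)"
    by (rule inj_on_inverseI[of _ g]) (rule homeomorphism_apply1[OF h])
  then have "inj_on BAext (sphere 0 1)" using eq by (simp add: inj_on_def)
  moreover have "BAext z \<noteq> BAext z'" if "z \<in> ball 0 1" "z' \<in> sphere 0 1" for z z'
    using norm_BAext_less[of z] norm_BAext_eq[of z'] that by auto
  then have "BAext ` (ball 0 1 - sphere 0 1) \<inter> BAext ` (sphere 0 1 - ball 0 1) = {}" by blast
  ultimately have "inj_on BAext (ball 0 1 \<union> sphere 0 1)"
    unfolding inj_on_Un using inj_on_BAext_ball by (intro conjI)
  then show inj: "inj_on BAext (cball 0 1)" by (simp only: cb)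
  have sph: "BAext ` sphere 0 1 = sphere 0 1"
  proof -
    have "BAext ` sphere 0 1 = h ` sphere 0 1" by (rule image_cong[OF refl]) (rule eq)
    then show ?thesis using homeomorphism_image1[OF h] by (rule trans)
  qed
  have ball: "BAext ` ball 0 1 = ball 0 1"
  proof -
    have "open (BAext ` ball 0 1)"
      using continuous_on_subset[OF continuous_on_BAext ball_subset_cball] inj_on_BAext_ball
      by (intro invariance_of_domain) auto
    then have "openin (top_of_set (ball 0 1)) (BAext ` ball 0 1)"
      using norm_BAext_less by (intro open_subset) auto
    moreover have "BAext ` ball 0 1 = ball 0 1 \<inter> BAext ` cball 0 1"
    proof -
      have "BAext ` cball 0 1 = BAext ` ball 0 1 \<union> sphere 0 1"
        using sph by (simp only: cb image_Un)
      moreover have "BAext ` ball 0 1 \<subseteq> ball 0 1" using norm_BAext_less by auto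
      ultimately show ?thesis by auto
    qed
    then have "closedin (top_of_set (ball 0 1)) (BAext ` ball 0 1)"
      using compact_imp_closed[OF compact_continuous_image[OF continuous_on_BAext compact_cball]]
      by (auto simp: closedin_closed)
    ultimately have "BAext ` ball 0 1 = {} \<or> BAext ` ball 0 1 = ball 0 1"
      using connected_ball[of "0::complex" 1] unfolding connected_clopen by blast
    then show ?thesis by simp
  qed
  have cball: "BAext ` cball 0 1 = cball 0 1"
    using sph ball by (simp only: cb image_Un)
  then obtain G where G: "homeomorphism (cball 0 1) (cball 0 1) BAext G"
    using homeomorphism_compact[OF compact_cball continuous_on_BAext cball inj] by blast
  then show "disk_extension h BAext" using eq ball by (auto simp: disk_extension_def)
  have "homeomorphism (ball 0 1) (ball 0 1) BAext G"
    by (rule homeomorphism_of_subsets[OF G]) (auto simp: ball)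
  then show "\<exists>G. homeomorphism (ball 0 1) (ball 0 1) BAext G" by blast
qed

text \<open>The lift is joined to the identity by the straight homotopy, along which the increment over a
  period stays \<open>2\<pi>\<close>.\<close>

lemma winding_number_lift: "winding_number (\<lambda>t. cis (\<phi> (2 * pi * t))) 0 = 1"
proof -
  define k where "k = (\<lambda>(s, t). cis ((1 - s) * \<phi> (2 * pi * t) + s * (2 * pi * t)))"
  have ends: "cis ((1 - s) * \<phi> (2 * pi) + s * (2 * pi)) = cis ((1 - s) * \<phi> 0)" for s
  proof -
    have "(1 - s) * \<phi> (2 * pi) + s * (2 * pi) = (1 - s) * \<phi> 0 + 2 * pi"
      using period[of 0] by (simp add: algebra_simps)
    then show ?thesis by (simp flip: cis_mult)
  qed
  have "homotopic_loops (- {0}) (\<lambda>t. cis (\<phi> (2 * pi * t))) (circlepath 0 1)"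
    unfolding homotopic_loops
  proof (intro exI[of _ k] conjI ballI)
    show "continuous_on ({0..1} \<times> {0..1}) k"
      unfolding k_def case_prod_unfold by (intro continuous_intros)
  qed (auto simp: k_def pathfinish_def pathstart_def ends circlepath_cis)
  then show ?thesis
    by (simp add: winding_number_homotopic_loops winding_number_circlepath_centre)
qed

text \<open>Expand the circle about \<open>z\<close> of radius \<open>r\<close> to the unit circle while its centre moves to \<open>0\<close>, without
  leaving the closed disk. By injectivity the image circle never meets the image of the
  centre, so the winding number is that of the boundary curve about \<open>0\<close>.\<close>

lemma orientation_preserving_BAext:
  assumes inj: "inj_on BAext (cball 0 1)"
  shows "orientation_preserving_on (ball 0 1) BAext"
  unfolding orientation_preserving_on_def
proof (intro allI impI)
  fix z :: complex and r :: real
  assume "r > 0 \<and> cball z r \<subseteq> ball 0 1"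
  then have r: "r > 0" "cball z r \<subseteq> ball 0 1" by auto
  then have zr: "norm z + r < 1" by (simp add: cball_subset_ball_iff)
  define R where "R s = r + s * (1 - r)" for s
  \<comment> \<open>The radius grows linearly from \<open>r\<close> to \<open>1\<close>, so \<open>norm z + r \<le> 1\<close> persists.\<close>
  define k where "k = (\<lambda>(s, t). BAext ((1 - s) *\<^sub>R z + R s *\<^sub>R cis (2 * pi * t)) - BAext ((1 - s) *\<^sub>R z))"
  have R: "R s > 0" if "s \<in> {0..1}" for s
  proof -
    have "R s = r * (1 - s) + s" by (simp add: R_def algebra_simps)
    then show ?thesis using that r by (cases "s = 0") (auto intro!: add_nonneg_pos)
  qed
  have in1: "(1 - s) *\<^sub>R z + R s *\<^sub>R cis (2 * pi * t) \<in> cball 0 1" if "s \<in> {0..1}" for s t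
  proof -
    have "norm ((1 - s) *\<^sub>R z + R s *\<^sub>R cis (2 * pi * t)) \<le> (1 - s) * norm z + R s"
      using R[OF that] that by (intro order_trans[OF norm_triangle_ineq]) simp
    also have "\<dots> = (1 - s) * (norm z + r) + s" by (simp add: R_def algebra_simps)
    also have "\<dots> \<le> (1 - s) * 1 + s" using zr that by (intro add_mono mult_left_mono) auto
    finally show ?thesis by simp
  qed
  have in2: "(1 - s) *\<^sub>R z \<in> cball 0 1" if "s \<in> {0..1}" for s
    using that zr r mult_mono[of "1 - s" 1 "norm z" 1] by auto
  have "homotopic_loops (- {0}) (\<lambda>t. (BAext \<circ> circlepath z r) t - BAext z) (\<lambda>t. cis (\<phi> (2 * pi * t)))"
    unfolding homotopic_loops
  proof (intro exI[of _ k] conjI ballI)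
    show "continuous_on ({0..1} \<times> {0..1}) k"
      unfolding k_def case_prod_unfold
      by (intro continuous_on_diff continuous_on_compose2[OF continuous_on_BAext])
         (use in1 in2 in \<open>auto intro!: continuous_intros simp: R_def\<close>)
    show "k \<in> {0..1} \<times> {0..1} \<rightarrow> - {0}"
    proof (clarsimp simp: k_def)
      fix s t :: real assume s: "0 \<le> s" "s \<le> 1"
        and e: "BAext ((1 - s) *\<^sub>R z + R s *\<^sub>R cis (2 * pi * t)) = BAext ((1 - s) *\<^sub>R z)"
      have "(1 - s) *\<^sub>R z + R s *\<^sub>R cis (2 * pi * t) = (1 - s) *\<^sub>R z"
        using inj_onD[OF inj e in1 in2] s by simp
      then show False using R[of s] s by simp
    qed
  qed (auto simp: k_def R_def pathfinish_def pathstart_def circlepath_cis BAext_cis)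
  then have "winding_number (\<lambda>t. (BAext \<circ> circlepath z r) t - BAext z) 0 = 1"
    by (simp only: winding_number_homotopic_loops winding_number_lift)
  then show "winding_number (BAext \<circ> circlepath z r) (BAext z) = 1"
    using winding_number_offset[of "BAext \<circ> circlepath z r" "BAext z"] by simp
qed

text \<open>\<open>BAext\<close> is differentiable off the origin; the value there is a convention on a null set.\<close>

definition dBAext :: "complex \<Rightarrow> complex \<Rightarrow>\<^sub>L complex" where
  "dBAext z = (if z = 0 then 0 else
     conj_map (\<i> * BAext z) (inverse (\<i> * z)) (BAx (- \<i> * Ln z)) (BAy (- \<i> * Ln z)))"

lemma BAext_deriv:
  assumes "norm z < 1" "z \<noteq> 0"
  shows "(BAext has_derivative blinfun_apply (dBAext z)) (at z)"
proof -
  define L where "L u = - \<i> * (Ln (u / z) + Ln z)" for u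
  have Lz: "L z = - \<i> * Ln z" using assms by (simp add: L_def)
  have pos: "Im (L z) > 0" using assms by (simp add: Lz)
  have "(L has_field_derivative inverse (\<i> * z)) (at z)"
    unfolding L_def using assms by (auto intro!: derivative_eq_intros simp: field_simps)
  then have dL: "(L has_derivative (\<lambda>e. inverse (\<i> * z) * e)) (at z)"
    unfolding has_field_derivative_def .
  have dB: "((\<lambda>u. BA (L u)) has_derivative
    (\<lambda>e. Re (inverse (\<i> * z) * e) *\<^sub>R BAx (L z) + Im (inverse (\<i> * z) * e) *\<^sub>R BAy (L z))) (at z)"
    using has_derivative_compose[OF dL BA_deriv[OF pos]] .
  have dE: "((\<lambda>v. exp (\<i> * v)) has_derivative (\<lambda>e. \<i> * exp (\<i> * BA (L z)) * e)) (at (BA (L z)))"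
    unfolding has_field_derivative_def[symmetric] by (auto intro!: derivative_eq_intros)
  have eq: "exp (\<i> * BA (L u)) = BAext u" if "u \<noteq> 0" for u
  proof -
    have "exp (\<i> * L u) = u" using that assms by (simp add: L_def exp_add)
    then show ?thesis using BAext_exp[of "L u"] by simp
  qed
  have dz: "blinfun_apply (dBAext z) = (\<lambda>e. \<i> * exp (\<i> * BA (L z)) *
    (Re (inverse (\<i> * z) * e) *\<^sub>R BAx (L z) + Im (inverse (\<i> * z) * e) *\<^sub>R BAy (L z)))"
    unfolding fun_eq_iff eq[OF assms(2)]
    unfolding Lz dBAext_def if_not_P[OF assms(2)]
    by (intro allI) (rule conj_map_apply)
  have "((\<lambda>u. exp (\<i> * BA (L u))) has_derivative blinfun_apply (dBAext z)) (at z)"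
    unfolding dz by (rule has_derivative_compose[OF dB dE])
  moreover have "\<forall>\<^sub>F u in at z. exp (\<i> * BA (L u)) = BAext u"
    by (rule eventually_mono[OF eventually_neq_at_within eq])
  ultimately show ?thesis
    using has_derivative_transform_eventually eq[OF assms(2)] UNIV_I by blast
qed

lemma continuous_on_dBAext: "continuous_on (ball 0 1 - {0}) (\<lambda>z. blinfun_apply (dBAext z) e)"
proof -
  have X: "continuous_on (ball 0 1 - {0}) (\<lambda>z. BAx (- \<i> * Ln z))"
    by (rule continuous_on_log[where I = "{0<..}"]) (use continuous_on_BAx in \<open>auto simp: BAx_period\<close>)
  have Y: "continuous_on (ball 0 1 - {0}) (\<lambda>z. BAy (- \<i> * Ln z))"
    by (rule continuous_on_log[where I = "{0<..}"]) (use continuous_on_BAy in \<open>auto simp: BAy_period\<close>)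
  have E: "continuous_on (ball 0 1 - {0}) BAext"
    by (rule continuous_on_subset[OF continuous_on_BAext]) auto
  have "continuous_on (ball 0 1 - {0}) (\<lambda>z. \<i> * BAext z *
    (Re (inverse (\<i> * z) * e) *\<^sub>R BAx (- \<i> * Ln z) + Im (inverse (\<i> * z) * e) *\<^sub>R BAy (- \<i> * Ln z)))"
    by (intro continuous_intros X Y E) auto
  then show ?thesis by (rule continuous_on_eq) (simp add: dBAext_def)
qed

text \<open>The factor \<open>norm (BAext z) / norm z\<close> from the two changes of coordinates is bounded, and the
  derivative of \<open>BA\<close> is bounded away from the real axis. So the derivative stays bounded at the
  origin, where it need not have a limit.\<close>

lemma norm_dBAext_le:
  assumes "norm z \<le> r" "r < 1"
  shows "norm (dBAext z) \<le> exp (4 * pi) * (sqrt (5 / 2) * (2 + 4 * pi / (- ln r)))"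
proof (cases "z = 0")
  case True
  have "- ln r \<ge> 0" using assms True by (cases "r = 0") auto
  then have "0 \<le> exp (4 * pi) * (sqrt (5 / 2) * (2 + 4 * pi / (- ln r)))"
    by (intro mult_nonneg_nonneg add_nonneg_nonneg divide_nonneg_nonneg) auto
  then show ?thesis using True by (simp add: dBAext_def)
next
  case False
  define y where "y = - ln (norm z)"
  have r: "0 < r" using assms False by (metis norm_le_zero_iff not_le order_trans)
  have y: "0 < - ln r" "- ln r \<le> y" using assms r False by (auto simp: y_def)
  have "(norm (dBAext z))\<^sup>2 \<le> (norm (\<i> * BAext z) * norm (inverse (\<i> * z)))\<^sup>2 *
      ((norm (BAx (- \<i> * Ln z)))\<^sup>2 + (norm (BAy (- \<i> * Ln z)))\<^sup>2)"
    unfolding dBAext_def if_not_P[OF False] by (rule norm_conj_map)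
  also have "\<dots> \<le> (exp (4 * pi))\<^sup>2 * (5 / 2 * (2 + 4 * pi / y)\<^sup>2)"
  proof (rule mult_mono)
    show "(norm (\<i> * BAext z) * norm (inverse (\<i> * z)))\<^sup>2 \<le> (exp (4 * pi))\<^sup>2"
    proof (rule power_mono)
      have "norm (BAext z) / norm z \<le> exp (4 * pi)"
        using norm_BAext_le[of z] False by (simp add: pos_divide_le_eq)
      then show "norm (\<i> * BAext z) * norm (inverse (\<i> * z)) \<le> exp (4 * pi)"
        by (simp only: norm_mult norm_inverse norm_ii mult_1 divide_inverse)
    qed simp
    show "(norm (BAx (- \<i> * Ln z)))\<^sup>2 + (norm (BAy (- \<i> * Ln z)))\<^sup>2 \<le> 5 / 2 * (2 + 4 * pi / y)\<^sup>2"
    proof -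
      have Im: "Im (- \<i> * Ln z) = y" using False by (simp add: y_def)
      show ?thesis using BA_distortion(2)[of "- \<i> * Ln z"] y unfolding Im by simp
    qed
  qed auto
  also have "\<dots> = (exp (4 * pi) * (sqrt (5 / 2) * (2 + 4 * pi / y)))\<^sup>2"
    by (simp add: power_mult_distrib)
  finally have "norm (dBAext z) \<le> exp (4 * pi) * (sqrt (5 / 2) * (2 + 4 * pi / y))"
    by (rule power2_le_imp_le) (use y in auto)
  also have "\<dots> \<le> exp (4 * pi) * (sqrt (5 / 2) * (2 + 4 * pi / (- ln r)))"
    using y by (intro mult_left_mono add_left_mono frac_le) auto
  finally show ?thesis .
qed

lemma dilatation_dBAext:
  assumes "norm z < 1" "z \<noteq> 0"
  shows "dilatation (dBAext z) \<le> ennreal (60 * sym_dist3 (- \<i> * Ln z))"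
proof (rule dilatation_le)
  let ?w = "- \<i> * Ln z"
  have pos: "Im ?w > 0" using assms by simp
  have "1 \<le> sym_dist (Re ?w) (Im ?w)" by (rule sym_dist_ge_1[OF pos])
  also have "\<dots> \<le> sym_dist3 ?w" by (simp add: sym_dist3_def)
  finally show "1 \<le> 60 * sym_dist3 ?w" by simp
  let ?c = "norm (\<i> * BAext z) * norm (inverse (\<i> * z))"
  have "(norm (dBAext z))\<^sup>2 \<le> ?c\<^sup>2 * ((norm (BAx ?w))\<^sup>2 + (norm (BAy ?w))\<^sup>2)"
    unfolding dBAext_def if_not_P[OF assms(2)] by (rule norm_conj_map)
  also have "\<dots> \<le> ?c\<^sup>2 * (60 * sym_dist3 ?w * Im (cnj (BAx ?w) * BAy ?w))"
    using BA_distortion(1)[OF pos] by (intro mult_left_mono) auto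
  also have "\<dots> = 60 * sym_dist3 ?w * jac (dBAext z)"
    using assms by (simp only: dBAext_def jac_conj_map if_False mult_ac)
  finally show "(norm (dBAext z))\<^sup>2 \<le> 60 * sym_dist3 ?w * jac (dBAext z)" .
qed

end

section \<open>Weak derivatives across a point\<close>

lemma lborel_complex: "lborel = distr (lborel \<Otimes>\<^sub>M lborel) borel (\<lambda>(x, y). Complex x y)"
proof (rule lborel_eqI)
  have m: "(\<lambda>(x, y). Complex x y) \<in> borel_measurable (lborel \<Otimes>\<^sub>M lborel)"
    unfolding Complex_eq by measurable
  fix l u :: complex assume lu: "\<And>b. b \<in> Basis \<Longrightarrow> l \<bullet> b \<le> u \<bullet> b"
  have le: "Re l \<le> Re u" "Im l \<le> Im u" using lu[of 1] lu[of \<i>] by (auto simp: Basis_complex_def inner_complex_def)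
  have "(\<lambda>(x, y). Complex x y) -` box l u \<inter> space (lborel \<Otimes>\<^sub>M lborel) = {Re l<..<Re u} \<times> {Im l<..<Im u}"
    by (auto simp: box_def Basis_complex_def inner_complex_def space_pair_measure)
  then show "emeasure (distr (lborel \<Otimes>\<^sub>M lborel) borel (\<lambda>(x, y). Complex x y)) (box l u) =
    ennreal (\<Prod>b\<in>Basis. (u - l) \<bullet> b)"
    using m le by (simp add: emeasure_distr lborel.emeasure_pair_measure_Times Basis_complex_def inner_complex_def
        ennreal_mult' complex_eq_iff)
qed simp

lemma measurable_Complex [measurable]:
  assumes [measurable]: "f \<in> borel_measurable M" "g \<in> borel_measurable M"
  shows "(\<lambda>x. Complex (f x) (g x)) \<in> borel_measurable M"
  unfolding Complex_eq by measurable

lemma nn_integral_complex: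
  assumes [measurable]: "f \<in> borel_measurable borel"
  shows "(\<integral>\<^sup>+z. f z \<partial>lborel) = (\<integral>\<^sup>+x. \<integral>\<^sup>+y. f (Complex x y) \<partial>lborel \<partial>lborel)"
proof -
  have "(\<integral>\<^sup>+z. f z \<partial>lborel) = (\<integral>\<^sup>+p. f (case p of (x, y) \<Rightarrow> Complex x y) \<partial>(lborel \<Otimes>\<^sub>M lborel))"
    by (subst lborel_complex, subst nn_integral_distr) auto
  also have "\<dots> = (\<integral>\<^sup>+x. \<integral>\<^sup>+y. f (case (x, y) of (x, y) \<Rightarrow> Complex x y) \<partial>lborel \<partial>lborel)"
    by (subst lborel.nn_integral_fst[symmetric]) auto
  finally show ?thesis by simp
qed

lemma integral_complex:
  fixes f :: "complex \<Rightarrow> 'b::{banach, second_countable_topology}"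
  assumes f: "integrable lborel f"
  shows "(LINT z|lborel. f z) = (LINT x|lborel. LINT y|lborel. f (Complex x y))"
    and "(LINT z|lborel. f z) = (LINT y|lborel. LINT x|lborel. f (Complex x y))"
proof -
  have [measurable]: "f \<in> borel_measurable borel" using f by auto
  have i: "integrable (lborel \<Otimes>\<^sub>M lborel) (\<lambda>(x, y). f (Complex x y))"
    using f by (subst (asm) lborel_complex) (auto simp: integrable_distr_eq split_beta')
  have e: "(LINT z|lborel. f z) = (LINT z|(lborel \<Otimes>\<^sub>M lborel). (\<lambda>(x, y). f (Complex x y)) z)"
    by (subst lborel_complex) (simp add: integral_distr split_beta')
  show "(LINT z|lborel. f z) = (LINT x|lborel. LINT y|lborel. f (Complex x y))"
    unfolding e using lborel_pair.integral_fst'[OF i] by simp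
  show "(LINT z|lborel. f z) = (LINT y|lborel. LINT x|lborel. f (Complex x y))"
    unfolding e using lborel_pair.integral_snd[OF i] by simp
qed

text \<open>An integrable derivative is handled by the fundamental theorem of calculus; otherwise the Bochner integral is \<open>0\<close> by convention.\<close>

lemma integral_derivative_compact_support:
  fixes g g' :: "real \<Rightarrow> complex"
  assumes d: "\<And>x. (g has_vector_derivative g' x) (at x)"
    and 0: "\<And>x. \<bar>x\<bar> \<ge> 1 \<Longrightarrow> g x = 0 \<and> g' x = 0"
  shows "(LINT x|lborel. g' x) = 0"
proof (cases "integrable lborel g'")
  case True
  have "(g' has_integral (g 1 - g (- 1))) {- 1..1}"
    by (rule fundamental_theorem_of_calculus) (auto intro: has_vector_derivative_at_within d)
  then have "(g' has_integral (g 1 - g (- 1))) UNIV"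
    by (rule has_integral_on_superset) (use 0 in auto)
  then have "(g' has_integral 0) UNIV" using 0[of 1] 0[of "- 1"] by simp
  with has_integral_integral_lborel[OF True] show ?thesis by (rule has_integral_unique)
qed (rule not_integrable_integral_eq)

text \<open>By Fubini, since only one line in each of the two directions meets the origin.\<close>

lemma integral_directional_derivative:
  fixes f :: "complex \<Rightarrow> complex"
  assumes d: "\<And>z. z \<noteq> 0 \<Longrightarrow> (f has_derivative f' z) (at z)"
    and 0: "\<And>z. z \<notin> ball 0 1 \<Longrightarrow> f z = 0 \<and> f' z = (\<lambda>_. 0)"
    and e: "e \<in> Basis" and int: "integrable lborel (\<lambda>z. f' z e)"
  shows "(LINT z|lborel. f' z e) = 0"
proof -
  have line: "((\<lambda>t. f (z t)) has_vector_derivative f' (z t) e) (at t)"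
    if "(z has_vector_derivative e) (at t)" "z t \<noteq> 0" for z t
    using has_derivative_compose[OF that(1)[unfolded has_vector_derivative_def] d[OF that(2)]]
      linear_scale[OF has_derivative_linear[OF d[OF that(2)]]]
    by (simp add: has_vector_derivative_def)
  have out: "f z = 0 \<and> f' z e = 0" if "\<bar>Re z\<bar> \<ge> 1 \<or> \<bar>Im z\<bar> \<ge> 1" for z
    using 0[of z] that abs_Re_le_cmod[of z] abs_Im_le_cmod[of z] by force
  have ae: "AE t in lborel. t \<noteq> (0::real)"
    by (rule AE_lborel_singleton)
  from e consider "e = 1" | "e = \<i>" by (auto simp: Basis_complex_def)
  then show ?thesis
  proof cases
    case 1
    have "(LINT x|lborel. f' (Complex x y) e) = 0" if "y \<noteq> 0" for y
    proof (rule integral_derivative_compact_support)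
      have "((\<lambda>x. Complex x y) has_vector_derivative e) (at x)" for x
        unfolding Complex_eq 1 by (auto intro!: derivative_eq_intros)
      from line[OF this] show "((\<lambda>x. f (Complex x y)) has_vector_derivative f' (Complex x y) e) (at x)" for x
        using that by (simp add: complex_eq_iff)
    qed (use out in auto)
    then have "AE y in lborel. (LINT x|lborel. f' (Complex x y) e) = 0"
      using ae by auto
    then have "(LINT y|lborel. LINT x|lborel. f' (Complex x y) e) = 0"
      by (rule integral_eq_zero_AE)
    then show ?thesis using integral_complex(2)[OF int] by simp
  next
    case 2
    have "(LINT y|lborel. f' (Complex x y) e) = 0" if "x \<noteq> 0" for x
    proof (rule integral_derivative_compact_support)
      have "((\<lambda>y. Complex x y) has_vector_derivative e) (at y)" for y
        unfolding Complex_eq 2 by (auto intro!: derivative_eq_intros)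
      from line[OF this] show "((\<lambda>y. f (Complex x y)) has_vector_derivative f' (Complex x y) e) (at y)" for y
        using that by (simp add: complex_eq_iff)
    qed (use out in auto)
    then have "AE x in lborel. (LINT y|lborel. f' (Complex x y) e) = 0"
      using ae by auto
    then have "(LINT x|lborel. LINT y|lborel. f' (Complex x y) e) = 0"
      by (rule integral_eq_zero_AE)
    then show ?thesis using integral_complex(1)[OF int] by simp
  qed
qed

lemma integrable_punctured:
  fixes f :: "complex \<Rightarrow> 'b::euclidean_space"
  assumes c: "continuous_on (ball 0 1 - {0}) f"
    and b: "\<And>r. r < 1 \<Longrightarrow> \<exists>B. \<forall>z. norm z \<le> r \<longrightarrow> norm (f z) \<le> B"
    and K: "compact K" "K \<subseteq> ball 0 1"
  shows "integrable lborel (\<lambda>z. indicator K z *\<^sub>R f z)"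
proof -
  have [measurable]: "K \<in> sets borel" using K(1) by (rule borel_compact)
  have "(\<lambda>z. indicator (K - {0}) z *\<^sub>R f z) \<in> borel_measurable borel"
    by (intro borel_measurable_continuous_on_indicator continuous_on_subset[OF c]) (use K in auto)
  then have "(\<lambda>z. indicator K z *\<^sub>R f z) \<in> borel_measurable borel"
    by (rule measurable_discrete_difference[of _ _ _ "{0}"]) (auto simp: indicator_def)
  then have m: "(\<lambda>z. indicator K z *\<^sub>R f z) \<in> borel_measurable lborel" by simp
  obtain r where r: "r < 1" "\<And>z. z \<in> K \<Longrightarrow> norm z \<le> r"
  proof (cases "K = {}")
    case False
    obtain z where "z \<in> K" "\<And>w. w \<in> K \<Longrightarrow> norm w \<le> norm z"
      using continuous_attains_sup[OF K(1) False, of norm] by (auto intro: continuous_intros)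
    then show thesis using that[of "norm z"] K(2) by auto
  qed (use that[of 0] in auto)
  then obtain B where B: "\<And>z. z \<in> K \<Longrightarrow> norm (f z) \<le> B" using b by meson
  show ?thesis
    by (rule integrableI_bounded_set[where A = K and B = B])
       (use m B emeasure_bounded_finite[OF compact_imp_bounded[OF K(1)]] in auto)
qed

lemma locally_integrable_punctured:
  fixes f :: "complex \<Rightarrow> 'b::euclidean_space"
  assumes "continuous_on (ball 0 1 - {0}) f"
    and "\<And>r. r < 1 \<Longrightarrow> \<exists>B. \<forall>z. norm z \<le> r \<longrightarrow> norm (f z) \<le> B"
  shows "locally_integrable_on f (ball 0 1)"
  unfolding locally_integrable_on_def
proof (intro allI impI)
  fix K :: "complex set" assume "compact K \<and> K \<subseteq> ball 0 1"
  then have "integrable lborel (\<lambda>z. indicator K z *\<^sub>R f z)"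
    using assms by (intro integrable_punctured) auto
  then show "f absolutely_integrable_on K"
    unfolding set_integrable_def by (simp add: integrable_completion)
qed

text \<open>Apply the vanishing of the integral of a directional derivative to the product of \<open>H\<close> and a test function.\<close>

lemma weak_derivative_punctured:
  fixes H :: "complex \<Rightarrow> complex" and D :: "complex \<Rightarrow> complex \<Rightarrow>\<^sub>L complex"
  assumes cH: "continuous_on (cball 0 1) H"
    and dH: "\<And>z. norm z < 1 \<Longrightarrow> z \<noteq> 0 \<Longrightarrow> (H has_derivative blinfun_apply (D z)) (at z)"
    and cD: "\<And>e. continuous_on (ball 0 1 - {0}) (\<lambda>z. blinfun_apply (D z) e)"
    and bD: "\<And>r. r < 1 \<Longrightarrow> \<exists>B. \<forall>z. norm z \<le> r \<longrightarrow> norm (D z) \<le> B"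
  shows "weak_derivative_on H D (ball 0 1)"
proof -
  have "bounded (H ` cball 0 1)"
    by (intro compact_imp_bounded compact_continuous_image cH compact_cball)
  then obtain BH where BH: "\<And>z. z \<in> cball 0 1 \<Longrightarrow> norm (H z) \<le> BH"
    unfolding bounded_iff by (meson imageI)
  have bH: "\<exists>B. \<forall>z. norm z \<le> r \<longrightarrow> norm (H z) \<le> B" if "r < 1" for r
    using BH that by (intro exI[of _ BH]) auto
  have cH': "continuous_on (ball 0 1 - {0}) H"
    by (rule continuous_on_subset[OF cH]) auto
  have bDe: "\<exists>B. \<forall>z. norm z \<le> r \<longrightarrow> norm (blinfun_apply (D z) e) \<le> B" if r: "r < 1" for r e
  proof -
    obtain B where B: "\<And>z. norm z \<le> r \<Longrightarrow> norm (D z) \<le> B" using bD[OF r] by blast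
    have "norm (blinfun_apply (D z) e) \<le> B * norm e" if "norm z \<le> r" for z
      using norm_blinfun[of "D z" e] mult_right_mono[OF B[OF that] norm_ge_zero[of e]] by linarith
    then show ?thesis by blast
  qed
  have eq: "(LINT x:ball 0 1|lebesgue. frechet_derivative \<psi> (at x) e *\<^sub>R H x) =
             - (LINT x:ball 0 1|lebesgue. \<psi> x *\<^sub>R blinfun_apply (D x) e)"
    if e: "e \<in> Basis" and \<psi>: "test_function (ball 0 1) \<psi>" for e \<psi>
  proof -
    define K where "K = closure {x. \<psi> x \<noteq> 0}"
    have K: "compact K" "K \<subseteq> ball 0 1" using \<psi> by (auto simp: test_function_def K_def)
    have Ck: "C_k n \<psi>" for n using \<psi> by (auto simp: test_function_def)
    have d\<psi>: "(\<psi> has_derivative frechet_derivative \<psi> (at z)) (at z)" for z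
      using Ck[of "Suc 0"] by (simp add: frechet_derivative_works[symmetric])
    have c\<psi>: "continuous_on UNIV \<psi>" using Ck[of 0] by simp
    have cd\<psi>: "continuous_on UNIV (\<lambda>z. frechet_derivative \<psi> (at z) e)" using Ck[of "Suc 0"] e by simp
    have off: "\<psi> z = 0" if "z \<notin> K" for z
      using that closure_subset[of "{x. \<psi> x \<noteq> 0}"] by (auto simp: K_def)
    have off': "frechet_derivative \<psi> (at z) = (\<lambda>_. 0)" if "z \<notin> K" for z
    proof -
      have "open (- K)" using compact_imp_closed[OF K(1)] by (simp add: open_Compl)
      then have "(\<psi> has_derivative (\<lambda>_. 0)) (at z)"
        by (rule has_derivative_transform_within_open[OF has_derivative_const[of 0]]) (use that off in auto)
      from frechet_derivative_at[OF this] show ?thesis by simp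
    qed
    have bounded: "\<exists>B. \<forall>z. norm z \<le> r \<longrightarrow> norm (a z *\<^sub>R F z) \<le> B"
      if a: "continuous_on UNIV a" and F: "\<And>r. r < 1 \<Longrightarrow> \<exists>B. \<forall>z. norm z \<le> r \<longrightarrow> norm (F z) \<le> B" and r: "r < 1"
      for a :: "complex \<Rightarrow> real" and F :: "complex \<Rightarrow> complex" and r
    proof -
      have "bounded (a ` cball 0 r)"
        by (intro compact_imp_bounded compact_continuous_image continuous_on_subset[OF a]) auto
      then obtain A where "\<forall>y\<in>a ` cball 0 r. norm y \<le> A" unfolding bounded_iff by blast
      then have A: "norm (a z) \<le> A" if "norm z \<le> r" for z using that by simp
      obtain B where B: "\<And>z. norm z \<le> r \<Longrightarrow> norm (F z) \<le> B" using F[OF r] by blast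
      have "norm (a z *\<^sub>R F z) \<le> A * B" if "norm z \<le> r" for z
        using A[OF that] B[OF that] by (simp add: mult_mono')
      then show ?thesis by blast
    qed
    let ?a = "\<lambda>z. frechet_derivative \<psi> (at z) e *\<^sub>R H z" and ?b = "\<lambda>z. \<psi> z *\<^sub>R blinfun_apply (D z) e"
    have ia: "integrable lborel (\<lambda>z. indicator K z *\<^sub>R ?a z)"
      by (intro integrable_punctured continuous_intros bounded continuous_on_subset[OF cd\<psi>] cH' K cd\<psi> bH) auto
    have ib: "integrable lborel (\<lambda>z. indicator K z *\<^sub>R ?b z)"
      by (intro integrable_punctured continuous_intros bounded continuous_on_subset[OF c\<psi>] cD K c\<psi> bDe) auto
    have ea: "indicator (ball 0 1) z *\<^sub>R ?a z = indicator K z *\<^sub>R ?a z" for z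
      using off'[of z] K(2) by (auto simp: indicator_def)
    have eb: "indicator (ball 0 1) z *\<^sub>R ?b z = indicator K z *\<^sub>R ?b z" for z
      using off[of z] K(2) by (auto simp: indicator_def)
    define f where "f z = \<psi> z *\<^sub>R H z" for z
    define f' where "f' z = (\<lambda>v. if z \<in> K then \<psi> z *\<^sub>R blinfun_apply (D z) v + frechet_derivative \<psi> (at z) v *\<^sub>R H z else 0)" for z
    have fe: "f' z e = indicator K z *\<^sub>R ?a z + indicator K z *\<^sub>R ?b z" for z
      by (simp add: f'_def indicator_def)
    have "(LINT z|lborel. f' z e) = 0"
    proof (rule integral_directional_derivative[OF _ _ e])
      show "(f has_derivative f' z) (at z)" if "z \<noteq> 0" for z
      proof (cases "z \<in> K")
        case True
        then have "norm z < 1" using K by auto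
        from has_derivative_scaleR[OF d\<psi> dH[OF this that]] True show ?thesis
          by (simp add: f_def[abs_def] f'_def)
      next
        case False
        have "open (- K)" using compact_imp_closed[OF K(1)] by (simp add: open_Compl)
        then have "(f has_derivative (\<lambda>_. 0)) (at z)"
          by (rule has_derivative_transform_within_open[OF has_derivative_const[of 0]]) (use False off in \<open>auto simp: f_def\<close>)
        then show ?thesis using False by (simp add: f'_def)
      qed
      show "f z = 0 \<and> f' z = (\<lambda>_. 0)" if "z \<notin> ball 0 1" for z
      proof -
        have "z \<notin> K" using K that by auto
        then show ?thesis using off[of z] by (simp add: f_def f'_def)
      qed
      show "integrable lborel (\<lambda>z. f' z e)" unfolding fe using ia ib by (rule Bochner_Integration.integrable_add)
    qed
    then have "(LINT z|lborel. indicator K z *\<^sub>R ?a z) + (LINT z|lborel. indicator K z *\<^sub>R ?b z) = 0"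
      unfolding fe using ia ib by (simp only: Bochner_Integration.integral_add)
    then show ?thesis
      unfolding set_lebesgue_integral_def ea eb
      using ia ib by (simp add: integral_completion add_eq_0_iff2)
  qed
  show ?thesis
    unfolding weak_derivative_on_def
    by (intro conjI ballI allI impI locally_integrable_punctured cH' bH cD bDe eq)
qed

section \<open>Integration in logarithmic polar coordinates\<close>

text \<open>The interval is covered by three periods.\<close>

lemma nn_integral_periodic_le:
  fixes J :: "real \<Rightarrow> ennreal"
  assumes [measurable]: "J \<in> borel_measurable borel"
    and per: "\<And>x. J (x + 2 * pi) = J x" and I: "- 2 * pi \<le> a" "b \<le> 4 * pi"
  shows "(\<integral>\<^sup>+x\<in>{a..b}. J x \<partial>lborel) \<le> 3 * (\<integral>\<^sup>+x\<in>{0..2 * pi}. J x \<partial>lborel)"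
proof -
  let ?K = "\<lambda>c. (\<integral>\<^sup>+x. J x * indicator {c..c + 2 * pi} x \<partial>lborel)"
  have shift: "?K c = ?K (c + 2 * pi)" for c
  proof -
    have "?K (c + 2 * pi) = (\<integral>\<^sup>+x. J (2 * pi + 1 * x) * indicator {c + 2 * pi..c + 2 * pi + 2 * pi} (2 * pi + 1 * x) \<partial>lborel)"
      by (subst nn_integral_real_affine[where c = 1 and t = "2 * pi"]) auto
    also have "\<dots> = ?K c"
      by (intro nn_integral_cong) (auto simp: per add.commute[of "2 * pi"] indicator_def)
    finally show ?thesis by simp
  qed
  have "J x * indicator {a..b} x \<le>
    J x * indicator {- 2 * pi..- 2 * pi + 2 * pi} x + J x * indicator {0..0 + 2 * pi} x
      + J x * indicator {2 * pi..2 * pi + 2 * pi} x" for x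
    using I by (auto simp: indicator_def)
  then have "(\<integral>\<^sup>+x\<in>{a..b}. J x \<partial>lborel) \<le> (\<integral>\<^sup>+x. J x * indicator {- 2 * pi..- 2 * pi + 2 * pi} x
      + J x * indicator {0..0 + 2 * pi} x + J x * indicator {2 * pi..2 * pi + 2 * pi} x \<partial>lborel)"
    by (rule nn_integral_mono)
  also have "\<dots> = ?K (- 2 * pi) + ?K 0 + ?K (2 * pi)"
    by (simp add: nn_integral_add)
  also have "\<dots> = 3 * ?K 0"
  proof -
    have "a + a + a = 3 * a" for a :: ennreal
    proof -
      have "(3::ennreal) = 1 + 1 + 1" by simp
      then show ?thesis by (simp only: distrib_right mult_1)
    qed
    moreover have "?K (- 2 * pi) = ?K 0" "?K (2 * pi) = ?K 0"
      using shift[of "- 2 * pi"] shift[of 0] by simp_all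
    ultimately show ?thesis by simp
  qed
  finally show ?thesis by simp
qed

lemma nn_integral_rotate:
  fixes f :: "complex \<Rightarrow> ennreal"
  assumes [measurable]: "f \<in> borel_measurable borel"
  shows "(\<integral>\<^sup>+z. f (\<i> * z) \<partial>lborel) = (\<integral>\<^sup>+z. f z \<partial>lborel)"
proof -
  have "(\<integral>\<^sup>+z. f z \<partial>lborel) = (\<integral>\<^sup>+x. \<integral>\<^sup>+y. f (Complex x y) \<partial>lborel \<partial>lborel)"
    by (rule nn_integral_complex) simp
  also have "\<dots> = (\<integral>\<^sup>+y. \<integral>\<^sup>+x. f (Complex x y) \<partial>lborel \<partial>lborel)"
    by (rule lborel_pair.Fubini'[symmetric]) measurable
  also have "\<dots> = (\<integral>\<^sup>+y. \<integral>\<^sup>+x. f (Complex (0 + (- 1) * x) y) \<partial>lborel \<partial>lborel)"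
  proof (rule nn_integral_cong)
    fix y :: real
    show "(\<integral>\<^sup>+x. f (Complex x y) \<partial>lborel) = (\<integral>\<^sup>+x. f (Complex (0 + (- 1) * x) y) \<partial>lborel)"
      by (subst nn_integral_real_affine[where c = "- 1" and t = 0]) auto
  qed
  also have "\<dots> = (\<integral>\<^sup>+z. f (\<i> * z) \<partial>lborel)"
    by (subst nn_integral_complex) (auto simp: Complex_eq algebra_simps intro!: nn_integral_cong arg_cong[where f = f])
  finally show ?thesis ..
qed

lemma nn_integral_rotate_power:
  fixes f :: "complex \<Rightarrow> ennreal"
  assumes f: "f \<in> borel_measurable borel"
  shows "(\<integral>\<^sup>+z. f (\<i> ^ k * z) \<partial>lborel) = (\<integral>\<^sup>+z. f z \<partial>lborel)"
proof (induction k)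
  case (Suc k)
  have m: "(\<lambda>z. f (\<i> ^ k * z)) \<in> borel_measurable borel"
    using f by measurable
  show ?case using nn_integral_rotate[OF m] Suc by (simp add: mult_ac)
qed simp

text \<open>Tonelli twice, with the one-dimensional substitutions \<open>y = x * tan \<theta>\<close> for fixed \<open>x\<close> and then
  \<open>x = cos \<theta> * exp s\<close> for fixed \<open>\<theta>\<close>. The restriction to a quarter of the plane keeps the range of
  \<open>\<theta>\<close> compact. The area element \<open>exp (2 * s)\<close> is estimated by \<open>1\<close>.\<close>

lemma polar_sector:
  fixes g :: "complex \<Rightarrow> ennreal"
  assumes [measurable]: "g \<in> borel_measurable borel" and b: "b > 0"
  defines "S \<equiv> {z. exp (- b) \<le> norm z \<and> norm z \<le> 1 \<and> \<bar>Im z\<bar> \<le> Re z}"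
  shows "(\<integral>\<^sup>+z\<in>S. g z \<partial>lborel) \<le>
    (\<integral>\<^sup>+\<theta>\<in>{- (pi / 4)..pi / 4}. (\<integral>\<^sup>+y\<in>{0..b}. g (of_real (exp (- y)) * cis \<theta>) \<partial>lborel) \<partial>lborel)"
proof -
  define G where "G z = g z * indicator S z" for z
  have S [measurable]: "S \<in> sets borel" unfolding S_def by measurable
  have G [measurable]: "G \<in> borel_measurable borel" unfolding G_def by measurable
  let ?I = "{- (pi / 4)..pi / 4}"
  have cos_pos: "cos \<theta> > 0" if "\<theta> \<in> ?I" for \<theta>
  proof (rule cos_gt_zero_pi)
    show "- (pi / 2) < \<theta>" "\<theta> < pi / 2"
      using that pi_gt_zero unfolding atLeastAtMost_iff by linarith+
  qed
  have out: "G z = 0" if "Re z \<le> 0" for z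
  proof -
    have "z \<notin> S"
    proof
      assume z: "z \<in> S"
      then have "Re z = 0" "Im z = 0" using that by (auto simp: S_def)
      then have "z = 0" by (simp add: complex_eq_iff)
      then show False using z by (simp add: S_def)
    qed
    then show ?thesis by (simp add: G_def)
  qed
  have tan_int: "(\<integral>\<^sup>+y. G (Complex x y) \<partial>lborel) =
    (\<integral>\<^sup>+\<theta>. G (Complex x (x * tan \<theta>)) * ennreal (x / (cos \<theta>)\<^sup>2) * indicator ?I \<theta> \<partial>lborel)"
    if x: "x > 0" for x
  proof -
    have "(\<integral>\<^sup>+y. G (Complex x y) \<partial>lborel) =
      (\<integral>\<^sup>+y. G (Complex x y) * indicator {x * tan (- (pi / 4))..x * tan (pi / 4)} y \<partial>lborel)"
      by (intro nn_integral_cong) (auto simp: G_def S_def indicator_def tan_45 tan_minus)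
    also have "\<dots> = (\<integral>\<^sup>+\<theta>. G (Complex x (x * tan \<theta>)) * ennreal (x / (cos \<theta>)\<^sup>2) * indicator ?I \<theta> \<partial>lborel)"
    proof (rule nn_integral_substitution_aux)
      show "((\<lambda>\<theta>. x * tan \<theta>) has_real_derivative x / (cos \<theta>)\<^sup>2) (at \<theta>)" if "\<theta> \<in> ?I" for \<theta>
        using cos_pos[OF that] by (auto intro!: derivative_eq_intros simp: field_simps)
      show "continuous_on ?I (\<lambda>\<theta>. x / (cos \<theta>)\<^sup>2)"
        using cos_pos by (intro continuous_intros) force
      show "0 \<le> x / (cos \<theta>)\<^sup>2" for \<theta> using x by simp
    qed auto
    finally show ?thesis .
  qed
  have tan_m [measurable]: "tan \<in> borel_measurable (borel :: real measure)"
    unfolding tan_def[abs_def] by measurable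
  have "(\<integral>\<^sup>+z\<in>S. g z \<partial>lborel) = (\<integral>\<^sup>+x. \<integral>\<^sup>+y. G (Complex x y) \<partial>lborel \<partial>lborel)"
    unfolding G_def[symmetric] by (rule nn_integral_complex) simp
  also have "\<dots> = (\<integral>\<^sup>+x. \<integral>\<^sup>+\<theta>. G (Complex x (x * tan \<theta>)) * ennreal (x / (cos \<theta>)\<^sup>2) * indicator ?I \<theta> \<partial>lborel \<partial>lborel)"
  proof (rule nn_integral_cong)
    fix x :: real
    show "(\<integral>\<^sup>+y. G (Complex x y) \<partial>lborel) =
      (\<integral>\<^sup>+\<theta>. G (Complex x (x * tan \<theta>)) * ennreal (x / (cos \<theta>)\<^sup>2) * indicator ?I \<theta> \<partial>lborel)"
      using tan_int[of x] out by (cases "x > 0") simp_all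
  qed
  also have "\<dots> = (\<integral>\<^sup>+\<theta>. \<integral>\<^sup>+x. G (Complex x (x * tan \<theta>)) * ennreal (x / (cos \<theta>)\<^sup>2) * indicator ?I \<theta> \<partial>lborel \<partial>lborel)"
    by (rule lborel_pair.Fubini'[symmetric]) measurable
  also have "\<dots> \<le> (\<integral>\<^sup>+\<theta>\<in>?I. (\<integral>\<^sup>+y\<in>{0..b}. g (of_real (exp (- y)) * cis \<theta>) \<partial>lborel) \<partial>lborel)"
  proof (rule nn_integral_mono)
    fix \<theta> :: real
    show "(\<integral>\<^sup>+x. G (Complex x (x * tan \<theta>)) * ennreal (x / (cos \<theta>)\<^sup>2) * indicator ?I \<theta> \<partial>lborel) \<le>
      (\<integral>\<^sup>+y\<in>{0..b}. g (of_real (exp (- y)) * cis \<theta>) \<partial>lborel) * indicator ?I \<theta>"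
    proof (cases "\<theta> \<in> ?I")
      case True
      define c where "c = cos \<theta>"
      have c: "c > 0" using cos_pos[OF True] by (simp add: c_def)
      have z: "Complex x (x * tan \<theta>) = of_real (x / c) * cis \<theta>" for x
        using c by (simp add: complex_eq_iff tan_def c_def)
      let ?F = "\<lambda>x. G (of_real (x / c) * cis \<theta>) * ennreal (x / c\<^sup>2)"
      have "(\<integral>\<^sup>+x. G (Complex x (x * tan \<theta>)) * ennreal (x / (cos \<theta>)\<^sup>2) * indicator ?I \<theta> \<partial>lborel) = (\<integral>\<^sup>+x. ?F x \<partial>lborel)"
        using True by (simp add: z c_def[symmetric])
      also have "\<dots> = (\<integral>\<^sup>+x. ?F x * indicator {c * exp (- b)..c * exp 0} x \<partial>lborel)"
      proof (intro nn_integral_cong)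
        fix x :: real
        have "x \<in> {c * exp (- b)..c * exp 0}" if "G (of_real (x / c) * cis \<theta>) \<noteq> 0"
        proof -
          have "Re (of_real (x / c) * cis \<theta>) > 0" using that out by (meson not_le)
          then have "x > 0" using c by (simp add: c_def[symmetric])
          moreover have "of_real (x / c) * cis \<theta> \<in> S" using that by (auto simp: G_def indicator_def split: if_splits)
          ultimately show ?thesis using c
            by (simp only: S_def mem_Collect_eq norm_mult norm_of_real norm_cis) (auto simp: field_simps)
        qed
        then show "?F x = ?F x * indicator {c * exp (- b)..c * exp 0} x"
          by (auto simp: indicator_def)
      qed
      also have "\<dots> = (\<integral>\<^sup>+s. ?F (c * exp s) * ennreal (c * exp s) * indicator {- b..0} s \<partial>lborel)"
      proof (rule nn_integral_substitution_aux)
        show "((\<lambda>s. c * exp s) has_real_derivative c * exp s) (at s)" for s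
          by (auto intro!: derivative_eq_intros)
        show "continuous_on {- b..0} (\<lambda>s. c * exp s)" by (intro continuous_intros)
      qed (use b c in auto)
      also have "\<dots> \<le> (\<integral>\<^sup>+s. g (of_real (exp s) * cis \<theta>) * indicator {- b..0} s \<partial>lborel)"
      proof (rule nn_integral_mono)
        fix s :: real
        have "?F (c * exp s) * ennreal (c * exp s) = G (of_real (exp s) * cis \<theta>) * ennreal (exp s * exp s)"
          using c by (simp add: mult.assoc ennreal_mult'[symmetric] power2_eq_square)
        also have "\<dots> \<le> g (of_real (exp s) * cis \<theta>) * 1" if "s \<le> 0"
          using that by (intro mult_mono) (auto simp: G_def indicator_def mult_le_one)
        finally show "?F (c * exp s) * ennreal (c * exp s) * indicator {- b..0} s \<le> g (of_real (exp s) * cis \<theta>) * indicator {- b..0} s"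
          by (auto simp: indicator_def)
      qed
      also have "\<dots> = (\<integral>\<^sup>+y. g (of_real (exp (0 + (- 1) * y)) * cis \<theta>) * indicator {- b..0} (0 + (- 1) * y) \<partial>lborel)"
        by (subst nn_integral_real_affine[where c = "- 1" and t = 0]) auto
      also have "\<dots> = (\<integral>\<^sup>+y\<in>{0..b}. g (of_real (exp (- y)) * cis \<theta>) \<partial>lborel)"
        by (intro nn_integral_cong) (auto simp: indicator_def)
      finally show ?thesis using True by simp
    qed simp
  qed
  finally show ?thesis .
qed

text \<open>Four rotated sectors cover the annulus, and each angular interval is covered by three periods;
  this is the origin of the factor \<open>12\<close>.\<close>

lemma polar_annulus:
  fixes g :: "complex \<Rightarrow> ennreal"
  assumes g [measurable]: "g \<in> borel_measurable borel" and b: "b > 0"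
  shows "(\<integral>\<^sup>+z\<in>{z. exp (- b) \<le> norm z \<and> norm z \<le> 1}. g z \<partial>lborel) \<le>
    12 * (\<integral>\<^sup>+\<theta>\<in>{0..2 * pi}. (\<integral>\<^sup>+y\<in>{0<..<b}. g (of_real (exp (- y)) * cis \<theta>) \<partial>lborel) \<partial>lborel)"
proof -
  define A where "A = {z. exp (- b) \<le> norm z \<and> norm (z::complex) \<le> 1}"
  define S where "S = {z. exp (- b) \<le> norm z \<and> norm z \<le> 1 \<and> \<bar>Im z\<bar> \<le> Re z}"
  define J where "J \<theta> = (\<integral>\<^sup>+y\<in>{0<..<b}. g (of_real (exp (- y)) * cis \<theta>) \<partial>lborel)" for \<theta>
  have cis_m [measurable]: "cis \<in> borel_measurable borel"
    by (intro borel_measurable_continuous_onI continuous_intros)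
  have J [measurable]: "J \<in> borel_measurable borel"
    unfolding J_def by measurable
  have S [measurable]: "S \<in> sets borel" unfolding S_def by measurable
  have ik: "\<i> ^ k = cis (of_nat k * (pi / 2))" for k
    using Complex.DeMoivre[of "pi / 2" k] unfolding cis_pi_half .
  have sector: "(\<integral>\<^sup>+z. g z * indicator S ((- \<i>) ^ k * z) \<partial>lborel) \<le> 3 * (\<integral>\<^sup>+x\<in>{0..2 * pi}. J x \<partial>lborel)"
    if k: "k < 4" for k
  proof -
    have inv: "(- \<i>) ^ k * (\<i> ^ k * z) = z" for z
      by (simp add: mult.assoc[symmetric] power_mult_distrib[symmetric])
    have "(\<integral>\<^sup>+z. g z * indicator S ((- \<i>) ^ k * z) \<partial>lborel) = (\<integral>\<^sup>+z\<in>S. g (\<i> ^ k * z) \<partial>lborel)"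
      by (subst nn_integral_rotate_power[where k = k, symmetric]) (auto simp: inv)
    also have "\<dots> \<le> (\<integral>\<^sup>+\<theta>\<in>{- (pi / 4)..pi / 4}.
        (\<integral>\<^sup>+y\<in>{0..b}. g (\<i> ^ k * (of_real (exp (- y)) * cis \<theta>)) \<partial>lborel) \<partial>lborel)"
      unfolding S_def by (rule polar_sector) (use b in measurable)
    also have "\<dots> = (\<integral>\<^sup>+\<theta>\<in>{- (pi / 4)..pi / 4}. J (of_nat k * (pi / 2) + 1 * \<theta>) \<partial>lborel)"
    proof (intro nn_integral_cong arg_cong2[where f = "(*)"] refl)
      fix \<theta> :: real
      have "AE y in lborel. y \<noteq> 0 \<and> y \<noteq> b" by (auto intro: AE_conjI AE_lborel_singleton)
      then have ae: "AE y in lborel. indicator {0..b} y = (indicator {0<..<b} y :: ennreal)"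
        by eventually_elim (auto simp: indicator_def)
      have e: "\<i> ^ k * (of_real (exp (- y)) * cis \<theta>) = of_real (exp (- y)) * cis (of_nat k * (pi / 2) + 1 * \<theta>)" for y
        by (simp add: ik cis_mult[symmetric])
      show "(\<integral>\<^sup>+y\<in>{0..b}. g (\<i> ^ k * (of_real (exp (- y)) * cis \<theta>)) \<partial>lborel) = J (of_nat k * (pi / 2) + 1 * \<theta>)"
        unfolding J_def e by (intro nn_integral_cong_AE) (use ae in eventually_elim, simp)
    qed
    also have "\<dots> = (\<integral>\<^sup>+\<theta>. J (of_nat k * (pi / 2) + 1 * \<theta>) *
        indicator {of_nat k * (pi / 2) - pi / 4..of_nat k * (pi / 2) + pi / 4} (of_nat k * (pi / 2) + 1 * \<theta>) \<partial>lborel)"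
      by (intro nn_integral_cong) (auto simp: indicator_def)
    also have "\<dots> = (\<integral>\<^sup>+\<theta>\<in>{of_nat k * (pi / 2) - pi / 4..of_nat k * (pi / 2) + pi / 4}. J \<theta> \<partial>lborel)"
      by (subst (2) nn_integral_real_affine[where c = 1 and t = "of_nat k * (pi / 2)"]) auto
    also have "\<dots> \<le> 3 * (\<integral>\<^sup>+x\<in>{0..2 * pi}. J x \<partial>lborel)"
    proof (rule nn_integral_periodic_le)
      show "J (x + 2 * pi) = J x" for x
        by (simp add: J_def flip: cis_mult)
      have "0 \<le> of_nat k * (pi / 2)" by simp
      then show "- 2 * pi \<le> of_nat k * (pi / 2) - pi / 4" using pi_gt_zero by linarith
      have "of_nat k * (pi / 2) \<le> 3 * (pi / 2)" using k by (intro mult_right_mono) auto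
      then show "of_nat k * (pi / 2) + pi / 4 \<le> 4 * pi" using pi_gt_zero by linarith
    qed simp
    finally show ?thesis .
  qed
  have cover: "g z * indicator A z \<le> (\<Sum>k<4. g z * indicator S ((- \<i>) ^ k * z))" for z
  proof (cases "z \<in> A")
    case True
    have n: "norm ((- \<i>) ^ k * z) = norm z" for k by (simp add: norm_mult norm_power)
    consider "\<bar>Im z\<bar> \<le> Re z" | "\<bar>Re z\<bar> \<le> Im z" | "\<bar>Im z\<bar> \<le> - Re z" | "\<bar>Re z\<bar> \<le> - Im z" by linarith
    then have "\<exists>k<4. (- \<i>) ^ k * z \<in> S"
    proof cases
      case 1 then show ?thesis using True by (intro exI[of _ 0]) (simp add: A_def S_def)
    next
      case 2 then show ?thesis using True n[of 1] by (intro exI[of _ 1]) (simp add: A_def S_def)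
    next
      case 3 then show ?thesis using True n[of 2] by (intro exI[of _ 2]) (simp add: A_def S_def)
    next
      case 4 then show ?thesis using True n[of 3]
        by (intro exI[of _ 3]) (simp add: A_def S_def numeral_3_eq_3)
    qed
    then obtain k where k: "k < 4" "(- \<i>) ^ k * z \<in> S" by blast
    have "g z * indicator A z = g z * indicator S ((- \<i>) ^ k * z)" using True k by simp
    also have "\<dots> \<le> (\<Sum>k<4. g z * indicator S ((- \<i>) ^ k * z))"
      by (rule member_le_sum) (use k in auto)
    finally show ?thesis .
  qed simp
  have "(\<integral>\<^sup>+z\<in>A. g z \<partial>lborel) \<le> (\<integral>\<^sup>+z. (\<Sum>k<4. g z * indicator S ((- \<i>) ^ k * z)) \<partial>lborel)"
    by (intro nn_integral_mono cover)
  also have "\<dots> = (\<Sum>k<4. \<integral>\<^sup>+z. g z * indicator S ((- \<i>) ^ k * z) \<partial>lborel)"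
    by (rule nn_integral_sum) measurable
  also have "\<dots> \<le> (\<Sum>k<(4::nat). 3 * (\<integral>\<^sup>+x\<in>{0..2 * pi}. J x \<partial>lborel))"
    by (intro sum_mono sector) auto
  also have "\<dots> = 12 * (\<integral>\<^sup>+x\<in>{0..2 * pi}. J x \<partial>lborel)"
    by (simp add: mult.assoc[symmetric])
  finally show ?thesis by (simp add: A_def J_def)
qed

section \<open>Integrability of the distortion\<close>

context circle_lift
begin

lemma sym_dist_period: "sym_dist (x + 2 * pi) t = sym_dist x t"
  using period[of "x + t"] period[of x] period[of "x - t"]
  by (simp add: sym_dist_def algebra_simps)

lemma sym_dist3_period: "sym_dist3 (w + 2 * of_real pi) = sym_dist3 w"
  using sym_dist_period[of "Re w"] sym_dist_period[of "Re w - Im w / 3"] sym_dist_period[of "Re w + Im w / 3"]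
  by (simp add: sym_dist3_def algebra_simps)

lemma continuous_on_sym_dist3: "continuous_on {w. Im w > 0} sym_dist3"
  unfolding sym_dist3_def sym_dist_def by (intro continuous_intros continuous_on_max) auto

text \<open>For fixed \<open>y\<close> translate \<open>\<theta>\<close>, which costs a factor \<open>3\<close> by periodicity; for fixed \<open>\<theta>\<close> substitute
  \<open>t = 2 * y / 3\<close>, which costs \<open>3 / 2\<close>.\<close>

lemma shifted_distortion_integral:
  fixes \<Psi> :: "real \<Rightarrow> ennreal"
  assumes [measurable]: "\<Psi> \<in> borel_measurable borel" and c: "\<bar>c\<bar> \<le> 1 / 3"
  shows "(\<integral>\<^sup>+\<theta>\<in>{0..2 * pi}. (\<integral>\<^sup>+y\<in>{0<..<pi / 2}. \<Psi> (sym_dist (\<theta> + c * y) (2 * y / 3)) \<partial>lborel) \<partial>lborel)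
    \<le> 9 / 2 * (\<integral>\<^sup>+\<theta>\<in>{0..2 * pi}. (\<integral>\<^sup>+t\<in>{0<..<pi / 2}. \<Psi> (sym_dist \<theta> t) \<partial>lborel) \<partial>lborel)"
proof -
  define P where "P \<theta> t = \<Psi> (sym_dist \<theta> t)" for \<theta> t
  have P [measurable]: "(\<lambda>x. P (f x) (g x)) \<in> borel_measurable M"
    if [measurable]: "f \<in> borel_measurable M" "g \<in> borel_measurable M" for f g M
    unfolding P_def sym_dist_def by measurable
  have scale: "(\<integral>\<^sup>+y\<in>{0<..<pi / 2}. P \<theta> (2 * y / 3) \<partial>lborel) \<le> 3 / 2 * (\<integral>\<^sup>+t\<in>{0<..<pi / 2}. P \<theta> t \<partial>lborel)" for \<theta>
  proof -
    have "(\<integral>\<^sup>+y\<in>{0<..<pi / 2}. P \<theta> (2 * y / 3) \<partial>lborel) =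
      ennreal (3 / 2) * (\<integral>\<^sup>+t. P \<theta> (2 * (0 + 3 / 2 * t) / 3) * indicator {0<..<pi / 2} (0 + 3 / 2 * t) \<partial>lborel)"
      by (subst nn_integral_real_affine[where c = "3 / 2" and t = 0]) auto
    also have "\<dots> \<le> ennreal (3 / 2) * (\<integral>\<^sup>+t\<in>{0<..<pi / 2}. P \<theta> t \<partial>lborel)"
      by (intro mult_left_mono nn_integral_mono) (auto simp: indicator_def)
    also have "ennreal (3 / 2) = 3 / 2" by (simp add: divide_ennreal[symmetric])
    finally show ?thesis .
  qed
  have shift: "(\<integral>\<^sup>+\<theta>\<in>{0..2 * pi}. P (\<theta> + c * y) s \<partial>lborel) \<le> 3 * (\<integral>\<^sup>+\<theta>\<in>{0..2 * pi}. P \<theta> s \<partial>lborel)"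
    if y: "y \<in> {0<..<pi / 2}" for y s
  proof -
    have cy: "\<bar>c * y\<bar> \<le> pi"
      using mult_mono[OF c, of "\<bar>y\<bar>" pi] y by (auto simp: abs_mult)
    have "(\<integral>\<^sup>+\<theta>\<in>{c * y..c * y + 2 * pi}. P \<theta> s \<partial>lborel) =
      (\<integral>\<^sup>+\<theta>. P (c * y + 1 * \<theta>) s * indicator {c * y..c * y + 2 * pi} (c * y + 1 * \<theta>) \<partial>lborel)"
      by (subst nn_integral_real_affine[where c = 1 and t = "c * y"]) auto
    also have "\<dots> = (\<integral>\<^sup>+\<theta>\<in>{0..2 * pi}. P (\<theta> + c * y) s \<partial>lborel)"
      by (intro nn_integral_cong) (auto simp: indicator_def add.commute)
    finally have "(\<integral>\<^sup>+\<theta>\<in>{0..2 * pi}. P (\<theta> + c * y) s \<partial>lborel) = (\<integral>\<^sup>+\<theta>\<in>{c * y..c * y + 2 * pi}. P \<theta> s \<partial>lborel)" ..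
    also have "\<dots> \<le> 3 * (\<integral>\<^sup>+\<theta>\<in>{0..2 * pi}. P \<theta> s \<partial>lborel)"
    proof (rule nn_integral_periodic_le)
      show "P (x + 2 * pi) s = P x s" for x by (simp add: P_def sym_dist_period)
    qed (use cy in \<open>auto simp: abs_le_iff\<close>)
    finally show ?thesis .
  qed
  let ?I = "indicator {0..2 * pi} :: real \<Rightarrow> ennreal" and ?J = "indicator {0<..<pi / 2} :: real \<Rightarrow> ennreal"
  have "(\<integral>\<^sup>+\<theta>\<in>{0..2 * pi}. (\<integral>\<^sup>+y\<in>{0<..<pi / 2}. P (\<theta> + c * y) (2 * y / 3) \<partial>lborel) \<partial>lborel)
    = (\<integral>\<^sup>+\<theta>. \<integral>\<^sup>+y. P (\<theta> + c * y) (2 * y / 3) * ?J y * ?I \<theta> \<partial>lborel \<partial>lborel)"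
    by (intro nn_integral_cong nn_integral_multc[symmetric]) measurable
  also have "\<dots> = (\<integral>\<^sup>+y. \<integral>\<^sup>+\<theta>. P (\<theta> + c * y) (2 * y / 3) * ?J y * ?I \<theta> \<partial>lborel \<partial>lborel)"
    by (rule lborel_pair.Fubini'[symmetric]) measurable
  also have "\<dots> \<le> (\<integral>\<^sup>+y. 3 * (\<integral>\<^sup>+\<theta>. P \<theta> (2 * y / 3) * ?J y * ?I \<theta> \<partial>lborel) \<partial>lborel)"
  proof (rule nn_integral_mono)
    fix y :: real
    show "(\<integral>\<^sup>+\<theta>. P (\<theta> + c * y) (2 * y / 3) * ?J y * ?I \<theta> \<partial>lborel) \<le> 3 * (\<integral>\<^sup>+\<theta>. P \<theta> (2 * y / 3) * ?J y * ?I \<theta> \<partial>lborel)"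
      using shift[of y "2 * y / 3"] by (cases "y \<in> {0<..<pi / 2}") auto
  qed
  also have "\<dots> = 3 * (\<integral>\<^sup>+y. \<integral>\<^sup>+\<theta>. P \<theta> (2 * y / 3) * ?J y * ?I \<theta> \<partial>lborel \<partial>lborel)"
    by (rule nn_integral_cmult) measurable
  also have "(\<integral>\<^sup>+y. \<integral>\<^sup>+\<theta>. P \<theta> (2 * y / 3) * ?J y * ?I \<theta> \<partial>lborel \<partial>lborel)
    = (\<integral>\<^sup>+\<theta>. \<integral>\<^sup>+y. P \<theta> (2 * y / 3) * ?J y * ?I \<theta> \<partial>lborel \<partial>lborel)"
    by (rule lborel_pair.Fubini') measurable
  also have "\<dots> = (\<integral>\<^sup>+\<theta>\<in>{0..2 * pi}. (\<integral>\<^sup>+y\<in>{0<..<pi / 2}. P \<theta> (2 * y / 3) \<partial>lborel) \<partial>lborel)"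
    by (intro nn_integral_cong nn_integral_multc) measurable
  also have "\<dots> \<le> (\<integral>\<^sup>+\<theta>\<in>{0..2 * pi}. (3 / 2 * (\<integral>\<^sup>+t\<in>{0<..<pi / 2}. P \<theta> t \<partial>lborel)) \<partial>lborel)"
    by (intro nn_integral_mono mult_right_mono scale) auto
  also have "\<dots> = 3 / 2 * (\<integral>\<^sup>+\<theta>\<in>{0..2 * pi}. (\<integral>\<^sup>+t\<in>{0<..<pi / 2}. P \<theta> t \<partial>lborel) \<partial>lborel)"
    by (subst nn_integral_cmult[symmetric]) (auto simp: mult_ac)
  also have "3 * (3 / 2 * (\<integral>\<^sup>+\<theta>\<in>{0..2 * pi}. (\<integral>\<^sup>+t\<in>{0<..<pi / 2}. P \<theta> t \<partial>lborel) \<partial>lborel)) =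
    9 / 2 * (\<integral>\<^sup>+\<theta>\<in>{0..2 * pi}. (\<integral>\<^sup>+t\<in>{0<..<pi / 2}. P \<theta> t \<partial>lborel) \<partial>lborel)"
  proof -
    have "3 * (3 / 2) = (9 / 2 :: ennreal)" by (simp add: ennreal_times_divide)
    then show ?thesis by (simp flip: mult.assoc)
  qed
  finally show ?thesis by (simp add: P_def mult_left_mono)
qed

text \<open>Outside the disk of radius \<open>exp (- \<pi> / 2)\<close> a monotone function of the maximum of three distortions is at
  most the sum of its three values, and each of these has a finite integral. Inside that disk the
  distortion is bounded.\<close>

lemma sym_dist3_integral_finite:
  fixes \<Psi> :: "real \<Rightarrow> ennreal"
  assumes mono\<Psi>: "mono \<Psi>" and [measurable]: "\<Psi> \<in> borel_measurable borel"
    and fin: "(\<integral>\<^sup>+\<theta>\<in>{0..2 * pi}. (\<integral>\<^sup>+t\<in>{0<..<pi / 2}. \<Psi> (sym_dist \<theta> t) \<partial>lborel) \<partial>lborel) < \<infinity>"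
    and top: "\<And>s. \<Psi> s < \<infinity>"
  shows "(\<integral>\<^sup>+z\<in>ball 0 1 - {0}. \<Psi> (sym_dist3 (- \<i> * Ln z)) \<partial>lborel) < \<infinity>"
proof -
  \<comment> \<open>The distortion is continuous on the punctured disk; the indicator extends it to a Borel function.\<close>
  define g where "g z = \<Psi> (indicator (ball 0 1 - {0}) z *\<^sub>R sym_dist3 (- \<i> * Ln z))" for z
  have "continuous_on (ball 0 1 - {0}) (\<lambda>z. sym_dist3 (- \<i> * Ln z))"
    by (rule continuous_on_log[where I = "{0<..}"]) (use continuous_on_sym_dist3 sym_dist3_period in auto)
  then have [measurable]: "(\<lambda>z. indicator (ball 0 1 - {0}) z *\<^sub>R sym_dist3 (- \<i> * Ln z)) \<in> borel_measurable borel"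
    by (intro borel_measurable_continuous_on_indicator) auto
  have g [measurable]: "g \<in> borel_measurable borel" unfolding g_def by measurable
  define A where "A = {z::complex. exp (- (pi / 2)) \<le> norm z \<and> norm z \<le> 1}"
  have [measurable]: "A \<in> sets borel" unfolding A_def by measurable
  obtain M where M: "\<And>x t. t \<ge> pi / 3 \<Longrightarrow> sym_dist x t \<le> M" using sym_dist_bounded by blast
  have split: "\<Psi> (sym_dist3 (- \<i> * Ln z)) * indicator (ball 0 1 - {0}) z \<le> g z * indicator A z + \<Psi> M * indicator (ball 0 1) z"
    for z :: complex
  proof (cases "z \<in> ball 0 1 - {0}")
    case True
    then have z: "z \<noteq> 0" "norm z < 1" by auto
    show ?thesis
    proof (cases "exp (- (pi / 2)) \<le> norm z")
      case True
      then have "z \<in> A" using z by (simp add: A_def)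
      then have "\<Psi> (sym_dist3 (- \<i> * Ln z)) * indicator (ball 0 1 - {0}) z = g z * indicator A z"
        using z by (simp add: g_def)
      then show ?thesis by simp
    next
      case False
      have "ln (norm z) \<le> ln (exp (- (pi / 2)))"
        by (rule ln_mono) (use False z in auto)
      then have y: "Im (- \<i> * Ln z) \<ge> pi / 2" using z by simp
      then have "sym_dist3 (- \<i> * Ln z) \<le> M"
        unfolding sym_dist3_def using pi_gt_zero by (intro max.boundedI M) linarith+
      then have "\<Psi> (sym_dist3 (- \<i> * Ln z)) \<le> \<Psi> M" by (rule monoD[OF mono\<Psi>])
      then show ?thesis using z by (simp add: add_increasing)
    qed
  qed simp
  have outer: "(\<integral>\<^sup>+z\<in>A. g z \<partial>lborel) < \<infinity>"
  proof -
    define J where "J c \<theta> = (\<integral>\<^sup>+y\<in>{0<..<pi / 2}. \<Psi> (sym_dist (\<theta> + c * y) (2 * y / 3)) \<partial>lborel)" for c \<theta>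
    define J0 where "J0 \<theta> = (\<integral>\<^sup>+y\<in>{0<..<pi / 2}. \<Psi> (sym_dist \<theta> y) \<partial>lborel)" for \<theta>
    have meas [measurable]: "(\<lambda>x. \<Psi> (sym_dist (f x) (h x))) \<in> borel_measurable N"
      if [measurable]: "f \<in> borel_measurable N" "h \<in> borel_measurable N" for f h N
      unfolding sym_dist_def by measurable
    have [measurable]: "J c \<in> borel_measurable borel" "J0 \<in> borel_measurable borel" for c
      unfolding J_def[abs_def] J0_def[abs_def] by measurable
    have gz: "g (of_real (exp (- y)) * cis \<theta>) \<le>
      \<Psi> (sym_dist \<theta> y) + \<Psi> (sym_dist (\<theta> + (- 1 / 3) * y) (2 * y / 3)) + \<Psi> (sym_dist (\<theta> + 1 / 3 * y) (2 * y / 3))"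
      if y: "y > 0" for y \<theta>
    proof -
      have max\<Psi>: "\<Psi> (max a b) \<le> \<Psi> a + \<Psi> b" for a b
        by (cases "a \<le> b") (auto simp: max_def add_increasing add_increasing2)
      have "exp (\<i> * Complex \<theta> y) = of_real (exp (- y)) * cis \<theta>"
        by (simp add: exp_eq_polar)
      then have "sym_dist3 (- \<i> * Ln (of_real (exp (- y)) * cis \<theta>)) = sym_dist3 (Complex \<theta> y)"
        by (rule periodic_log[of sym_dist3, OF sym_dist3_period])
      moreover have "of_real (exp (- y)) * cis \<theta> \<in> ball 0 1 - {0}"
        using y by (simp add: norm_mult)
      ultimately have "g (of_real (exp (- y)) * cis \<theta>) = \<Psi> (sym_dist3 (Complex \<theta> y))" by (simp add: g_def)
      also have "\<dots> \<le> \<Psi> (sym_dist \<theta> y) + (\<Psi> (sym_dist (\<theta> - y / 3) (2 * y / 3)) + \<Psi> (sym_dist (\<theta> + y / 3) (2 * y / 3)))"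
        unfolding sym_dist3_def complex.sel by (intro order_trans[OF max\<Psi>] add_left_mono max\<Psi>)
      finally show ?thesis by (simp add: add.assoc)
    qed
    have "(\<integral>\<^sup>+z\<in>A. g z \<partial>lborel) \<le>
      12 * (\<integral>\<^sup>+\<theta>\<in>{0..2 * pi}. (\<integral>\<^sup>+y\<in>{0<..<pi / 2}. g (of_real (exp (- y)) * cis \<theta>) \<partial>lborel) \<partial>lborel)"
      unfolding A_def by (rule polar_annulus) auto
    also have "(\<integral>\<^sup>+\<theta>\<in>{0..2 * pi}. (\<integral>\<^sup>+y\<in>{0<..<pi / 2}. g (of_real (exp (- y)) * cis \<theta>) \<partial>lborel) \<partial>lborel) \<le>
      (\<integral>\<^sup>+\<theta>. (J0 \<theta> + J (- 1 / 3) \<theta> + J (1 / 3) \<theta>) * indicator {0..2 * pi} \<theta> \<partial>lborel)"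
    proof (intro nn_integral_mono mult_right_mono)
      fix \<theta> :: real
      have "(\<integral>\<^sup>+y\<in>{0<..<pi / 2}. g (of_real (exp (- y)) * cis \<theta>) \<partial>lborel) \<le>
        (\<integral>\<^sup>+y. \<Psi> (sym_dist \<theta> y) * indicator {0<..<pi / 2} y +
          \<Psi> (sym_dist (\<theta> + (- 1 / 3) * y) (2 * y / 3)) * indicator {0<..<pi / 2} y +
          \<Psi> (sym_dist (\<theta> + 1 / 3 * y) (2 * y / 3)) * indicator {0<..<pi / 2} y \<partial>lborel)"
      proof (rule nn_integral_mono)
        fix y :: real
        show "g (of_real (exp (- y)) * cis \<theta>) * indicator {0<..<pi / 2} y \<le>
          \<Psi> (sym_dist \<theta> y) * indicator {0<..<pi / 2} y +
          \<Psi> (sym_dist (\<theta> + (- 1 / 3) * y) (2 * y / 3)) * indicator {0<..<pi / 2} y +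
          \<Psi> (sym_dist (\<theta> + 1 / 3 * y) (2 * y / 3)) * indicator {0<..<pi / 2} y"
          using gz[of y \<theta>] by (cases "y \<in> {0<..<pi / 2}") auto
      qed
      also have "\<dots> = J0 \<theta> + J (- 1 / 3) \<theta> + J (1 / 3) \<theta>"
        unfolding J_def J0_def by (simp add: nn_integral_add)
      finally show "(\<integral>\<^sup>+y\<in>{0<..<pi / 2}. g (of_real (exp (- y)) * cis \<theta>) \<partial>lborel) \<le> J0 \<theta> + J (- 1 / 3) \<theta> + J (1 / 3) \<theta>" .
    qed simp
    also have "\<dots> = (\<integral>\<^sup>+\<theta>\<in>{0..2 * pi}. J0 \<theta> \<partial>lborel) + (\<integral>\<^sup>+\<theta>\<in>{0..2 * pi}. J (- 1 / 3) \<theta> \<partial>lborel)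
        + (\<integral>\<^sup>+\<theta>\<in>{0..2 * pi}. J (1 / 3) \<theta> \<partial>lborel)"
      by (simp add: distrib_right nn_integral_add)
    also have "\<dots> \<le> (\<integral>\<^sup>+\<theta>\<in>{0..2 * pi}. J0 \<theta> \<partial>lborel) + 9 / 2 * (\<integral>\<^sup>+\<theta>\<in>{0..2 * pi}. J0 \<theta> \<partial>lborel)
        + 9 / 2 * (\<integral>\<^sup>+\<theta>\<in>{0..2 * pi}. J0 \<theta> \<partial>lborel)"
      unfolding J_def J0_def by (intro add_mono order_refl shifted_distortion_integral) auto
    finally have le: "(\<integral>\<^sup>+z\<in>A. g z \<partial>lborel) \<le> 12 * ((\<integral>\<^sup>+\<theta>\<in>{0..2 * pi}. J0 \<theta> \<partial>lborel)
        + 9 / 2 * (\<integral>\<^sup>+\<theta>\<in>{0..2 * pi}. J0 \<theta> \<partial>lborel) + 9 / 2 * (\<integral>\<^sup>+\<theta>\<in>{0..2 * pi}. J0 \<theta> \<partial>lborel))"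
      by (simp add: mult_left_mono)
    also have "\<dots> < \<infinity>"
    proof -
      have "(\<integral>\<^sup>+\<theta>\<in>{0..2 * pi}. J0 \<theta> \<partial>lborel) < \<infinity>" using fin by (simp only: J0_def)
      moreover have "(9 / 2 :: ennreal) = ennreal (9 / 2)" by (simp add: divide_ennreal[symmetric])
      then have "(9 / 2 :: ennreal) < \<infinity>" by (simp only: infinity_ennreal_def ennreal_less_top)
      ultimately show ?thesis by (auto simp: ennreal_mult_less_top)
    qed
    finally show ?thesis .
  qed
  have inner: "\<Psi> M * emeasure lborel (ball (0::complex) 1) < \<infinity>"
    using top[of M] emeasure_bounded_finite[OF bounded_ball, of "0::complex" 1] by (simp add: ennreal_mult_less_top)
  have "(\<integral>\<^sup>+z\<in>ball 0 1 - {0}. \<Psi> (sym_dist3 (- \<i> * Ln z)) \<partial>lborel) \<le>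
    (\<integral>\<^sup>+z\<in>A. g z \<partial>lborel) + \<Psi> M * emeasure lborel (ball (0::complex) 1)"
  proof -
    have "(\<integral>\<^sup>+z\<in>ball 0 1 - {0}. \<Psi> (sym_dist3 (- \<i> * Ln z)) \<partial>lborel) \<le>
      (\<integral>\<^sup>+z. g z * indicator A z + \<Psi> M * indicator (ball 0 1) z \<partial>lborel)"
      by (intro nn_integral_mono split)
    also have "\<dots> = (\<integral>\<^sup>+z\<in>A. g z \<partial>lborel) + \<Psi> M * emeasure lborel (ball (0::complex) 1)"
    proof -
      have [measurable]: "ball (0::complex) 1 \<in> sets borel" by simp
      have "(\<lambda>z::complex. \<Psi> M * indicator (ball 0 1) z) \<in> borel_measurable borel" by measurable
      then show ?thesis by (subst nn_integral_add) (auto simp: nn_integral_cmult_indicator)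
    qed
    finally show ?thesis .
  qed
  also have "\<dots> < \<infinity>" using outer inner by simp
  finally show ?thesis .
qed

lemma rho_c_eq_sym_dist:
  assumes lift: "\<And>x. h (cis x) = cis (\<phi> x)" and t: "0 < t" "t < pi / 2"
  shows "rho_c h \<theta> t = sym_dist \<theta> t"
proof -
  have "arc_len (h (cis a)) (h (cis b)) = \<phi> b - \<phi> a" if "a < b" "b < a + 2 * pi" for a b
  proof -
    have "\<phi> b < \<phi> a + 2 * pi" using that by (simp flip: period)
    then have "Arg2pi (cis (\<phi> b - \<phi> a)) = \<phi> b - \<phi> a"
      using that by (intro Arg2pi_unique[of 1]) (auto simp: cis_conv_exp)
    then show ?thesis by (simp add: arc_len_def lift cis_divide)
  qed
  then show ?thesis using t pi_gt_zero by (simp add: rho_c_def sym_dist_def)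
qed

lemma finite_distortion_BAext:
  assumes "homeomorphism (sphere 0 1) (sphere 0 1) h g" "\<And>x. h (cis x) = cis (\<phi> x)"
  shows "finite_distortion (ball 0 1) (ball 0 1) BAext dBAext"
proof -
  have bound: "\<exists>B. \<forall>z. norm z \<le> r \<longrightarrow> norm (dBAext z) \<le> B" if "r < 1" for r
    using norm_dBAext_le[OF _ that] by blast
  have weak: "weak_derivative_on BAext dBAext (ball 0 1)"
    by (rule weak_derivative_punctured[OF continuous_on_BAext BAext_deriv continuous_on_dBAext bound])
  have jac: "locally_integrable_on (\<lambda>z. jac (dBAext z)) (ball 0 1)"
  proof (rule locally_integrable_punctured)
    show "continuous_on (ball 0 1 - {0}) (\<lambda>z. jac (dBAext z))"
      unfolding jac_def by (intro continuous_intros continuous_on_dBAext)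
    fix r :: real assume "r < 1"
    then obtain B where B: "\<And>z. norm z \<le> r \<Longrightarrow> norm (dBAext z) \<le> B" using bound by blast
    have "\<bar>jac (dBAext z)\<bar> \<le> 2 * (B * B)" if z: "norm z \<le> r" for z
    proof -
      have e: "norm (blinfun_apply (dBAext z) e) \<le> B" if "norm e = 1" for e
        using norm_blinfun[of "dBAext z" e] B[OF z] that by simp
      have 1: "\<bar>Re (blinfun_apply (dBAext z) 1)\<bar> \<le> B" "\<bar>Im (blinfun_apply (dBAext z) 1)\<bar> \<le> B"
        using e[of 1] abs_Re_le_cmod[of "blinfun_apply (dBAext z) 1"] abs_Im_le_cmod[of "blinfun_apply (dBAext z) 1"]
        by (simp_all add: norm_ii)
      have 2: "\<bar>Re (blinfun_apply (dBAext z) \<i>)\<bar> \<le> B" "\<bar>Im (blinfun_apply (dBAext z) \<i>)\<bar> \<le> B"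
        using e[of \<i>] abs_Re_le_cmod[of "blinfun_apply (dBAext z) \<i>"] abs_Im_le_cmod[of "blinfun_apply (dBAext z) \<i>"]
        by (simp_all add: norm_ii)
      have "\<bar>Re (blinfun_apply (dBAext z) 1) * Im (blinfun_apply (dBAext z) \<i>)\<bar> \<le> B * B"
        "\<bar>Re (blinfun_apply (dBAext z) \<i>) * Im (blinfun_apply (dBAext z) 1)\<bar> \<le> B * B"
        unfolding abs_mult using 1 2 by (intro mult_mono'; simp)+
      then show ?thesis unfolding jac_def by linarith
    qed
    then show "\<exists>B. \<forall>z. norm z \<le> r \<longrightarrow> norm (jac (dBAext z)) \<le> B" by auto
  qed
  have "AE z in lborel. z \<in> ball 0 1 \<longrightarrow> dilatation (dBAext z) < \<infinity>"
    using AE_lborel_singleton[of "0::complex"]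
  proof eventually_elim
    case (elim z)
    have "dilatation (dBAext z) < \<infinity>" if "norm z < 1"
      using dilatation_dBAext[OF that elim] ennreal_less_top by (metis infinity_ennreal_def le_less_trans)
    then show ?case by simp
  qed
  then have ae: "AE z in lebesgue. z \<in> ball 0 1 \<longrightarrow> dilatation (dBAext z) < \<infinity>"
    by (rule AE_completion)
  show ?thesis
    unfolding finite_distortion_def
    using disk_extension_BAext(3)[OF assms] orientation_preserving_BAext[OF disk_extension_BAext(2)[OF assms]] weak jac ae
    by simp
qed

end

theorem theorem1p4:
  shows "\<exists>C\<^sub>0::real. C\<^sub>0 > 0 \<and>
    (\<forall>(\<Phi>::real \<Rightarrow> real) (h::complex \<Rightarrow> complex) (q::real).
       \<Phi> \<in> {0..} \<rightarrow> {0..} \<and> mono_on {0..} \<Phi> \<and> convex_on {0..} \<Phi> \<and>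
       circle_homeo_op h \<and> q > 0 \<and>
       (\<integral>\<^sup>+\<theta>\<in>{0..2*pi}. (\<integral>\<^sup>+t\<in>{0<..<pi/2}. ennreal (\<Phi> (q * rho_c h \<theta> t)) \<partial>lborel) \<partial>lborel) < \<infinity>
       \<longrightarrow>
       (\<exists>H D. disk_extension h H \<and> finite_distortion (ball 0 1) (ball 0 1) H D \<and>
          (\<integral>\<^sup>+z\<in>ball 0 1. ennreal (\<Phi> (q * inverse C\<^sub>0 * enn2real (dilatation (D z)))) \<partial>lebesgue) < \<infinity>))"
proof (intro exI[of _ 60] conjI allI impI)
  fix \<Phi> :: "real \<Rightarrow> real" and h :: "complex \<Rightarrow> complex" and q :: real
  assume asm: "\<Phi> \<in> {0..} \<rightarrow> {0..} \<and> mono_on {0..} \<Phi> \<and> convex_on {0..} \<Phi> \<and>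
       circle_homeo_op h \<and> q > 0 \<and>
       (\<integral>\<^sup>+\<theta>\<in>{0..2*pi}. (\<integral>\<^sup>+t\<in>{0<..<pi/2}. ennreal (\<Phi> (q * rho_c h \<theta> t)) \<partial>lborel) \<partial>lborel) < \<infinity>"
  then have mono\<Phi>: "mono_on {0..} \<Phi>" and h: "circle_homeo_op h" and q: "q > 0"
    and fin: "(\<integral>\<^sup>+\<theta>\<in>{0..2*pi}. (\<integral>\<^sup>+t\<in>{0<..<pi/2}. ennreal (\<Phi> (q * rho_c h \<theta> t)) \<partial>lborel) \<partial>lborel) < \<infinity>"
    by blast+
  obtain \<phi> g where "circle_lift \<phi>" and lift: "\<And>x. h (cis x) = cis (\<phi> x)"
    and g: "homeomorphism (sphere 0 1) (sphere 0 1) h g"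
    using circle_homeo_op_lift[OF h] by blast
  then interpret circle_lift \<phi> by blast
  \<comment> \<open>Truncation at \<open>0\<close> makes the function monotone, hence Borel, on the whole line.\<close>
  define \<Psi>r where "\<Psi>r s = \<Phi> (max 0 (q * s))" for s
  define \<Psi> where "\<Psi> s = ennreal (\<Psi>r s)" for s
  have monor: "mono \<Psi>r"
    unfolding \<Psi>r_def using q by (intro monoI mono_onD[OF mono\<Phi>] max.mono mult_left_mono) auto
  then have mono\<Psi>: "mono \<Psi>" unfolding \<Psi>_def by (auto simp: mono_def intro: ennreal_leI)
  have meas: "\<Psi> \<in> borel_measurable borel"
    unfolding \<Psi>_def using borel_measurable_mono[OF monor] by measurable
  have pos: "\<Psi> s = ennreal (\<Phi> (q * s))" if "s \<ge> 0" for s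
    using that q by (simp add: \<Psi>_def \<Psi>r_def)
  have rho: "ennreal (\<Phi> (q * rho_c h \<theta> t)) = \<Psi> (sym_dist \<theta> t)" if "t \<in> {0<..<pi / 2}" for \<theta> t
    using that rho_c_eq_sym_dist[of h t \<theta>, OF lift] sym_dist_ge_1[of t \<theta>] by (simp add: pos)
  have "(\<integral>\<^sup>+t\<in>{0<..<pi/2}. ennreal (\<Phi> (q * rho_c h \<theta> t)) \<partial>lborel) = (\<integral>\<^sup>+t\<in>{0<..<pi/2}. \<Psi> (sym_dist \<theta> t) \<partial>lborel)" for \<theta>
    by (intro nn_integral_cong) (use rho in \<open>auto simp: indicator_def\<close>)
  with fin have "(\<integral>\<^sup>+\<theta>\<in>{0..2*pi}. (\<integral>\<^sup>+t\<in>{0<..<pi/2}. \<Psi> (sym_dist \<theta> t) \<partial>lborel) \<partial>lborel) < \<infinity>"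
    by (simp only:)
  then have fin': "(\<integral>\<^sup>+z\<in>ball 0 1 - {0}. \<Psi> (sym_dist3 (- \<i> * Ln z)) \<partial>lborel) < \<infinity>"
    by (intro sym_dist3_integral_finite mono\<Psi> meas) (auto simp: \<Psi>_def)
  have "(\<integral>\<^sup>+z\<in>ball 0 1. ennreal (\<Phi> (q * inverse 60 * enn2real (dilatation (dBAext z)))) \<partial>lebesgue)
    = (\<integral>\<^sup>+z\<in>ball 0 1. ennreal (\<Phi> (q * inverse 60 * enn2real (dilatation (dBAext z)))) \<partial>lborel)"
    by (rule nn_integral_completion)
  also have "\<dots> \<le> (\<integral>\<^sup>+z\<in>ball 0 1 - {0}. \<Psi> (sym_dist3 (- \<i> * Ln z)) \<partial>lborel)"
  proof (rule nn_integral_mono_AE)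
    show "AE z in lborel. ennreal (\<Phi> (q * inverse 60 * enn2real (dilatation (dBAext z)))) * indicator (ball 0 1) z
      \<le> \<Psi> (sym_dist3 (- \<i> * Ln z)) * indicator (ball 0 1 - {0}) z"
      using AE_lborel_singleton[of "0::complex"]
    proof eventually_elim
      case (elim z)
      show ?case
      proof (cases "z \<in> ball 0 1")
        case True
        then have z: "norm z < 1" by simp
        have pos1: "1 \<le> sym_dist3 (- \<i> * Ln z)"
          unfolding sym_dist3_def using z elim by (intro max.coboundedI1 sym_dist_ge_1) simp
        have "enn2real (dilatation (dBAext z)) \<le> 60 * sym_dist3 (- \<i> * Ln z)"
          using dilatation_dBAext[OF z elim] pos1 by (intro enn2real_leI) auto
        then have "q * inverse 60 * enn2real (dilatation (dBAext z)) \<le> q * inverse 60 * (60 * sym_dist3 (- \<i> * Ln z))"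
          using q by (intro mult_left_mono) auto
        then have "\<Phi> (q * inverse 60 * enn2real (dilatation (dBAext z))) \<le> \<Phi> (q * sym_dist3 (- \<i> * Ln z))"
          using q pos1 by (intro mono_onD[OF mono\<Phi>]) auto
        then show ?thesis using True elim pos1 by (simp add: pos ennreal_leI)
      qed simp
    qed
  qed
  finally have "(\<integral>\<^sup>+z\<in>ball 0 1. ennreal (\<Phi> (q * inverse 60 * enn2real (dilatation (dBAext z)))) \<partial>lebesgue) < \<infinity>"
    using fin' by (rule le_less_trans)
  then show "\<exists>H D. disk_extension h H \<and> finite_distortion (ball 0 1) (ball 0 1) H D \<and>
          (\<integral>\<^sup>+z\<in>ball 0 1. ennreal (\<Phi> (q * inverse 60 * enn2real (dilatation (D z)))) \<partial>lebesgue) < \<infinity>"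
    using disk_extension_BAext(1)[OF g lift] finite_distortion_BAext[OF g lift] by blast
qed simp

end
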